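(* Let $r>0$, let $\Omega$ be a measurable space, and let $\mu^{P_r}:C[a,b]\times\mathbb{R}\times[a,b]\to(C[a,b]\times\mathbb{R})^*$ be given by $$\mu^{P_r}(u,z_0,t)=\mu^{\Delta_n}(u,z_0,t)\quad\text{if }(u,z_0)\in\overline V_n\setminus\overline V_{n-1},\qquad\mu^{\Delta_n}\in S^{\Delta_n}\ (n\ge1).$$ Let $u\in\mathcal{M}(\Omega;C[a,b])$ and $z_0\in\mathcal{M}(\Omega;\mathbb{R})$. Then $L_r^\Omega:\Omega\to\mathcal{L}(C[a,b]\times\mathbb{R};L^\infty(a,b))$, $$[(L_r^\Omega(x))(v,y_0)](t)=\langle\mu^{P_r}(u(x,\cdot),z_0(x),t),(v,y_0)\rangle,\qquad(v,y_0)\in C[a,b]\times\mathbb{R},$$ satisfies $$L_r^\Omega(x)\in G^{P_r}(u(x,\cdot),z_0(x))\quad\text{for all }x\in\Omega.$$ Let moreover $h\in\mathcal{M}(\Omega;C[a,b])$ and $y\in\mathcal{M}(\Omega;\mathbb{R})$. Then $$(x,t)\mapsto[(L_r^\Omega(x))(h(x,\cdot),y(x))](t)=\langle\mu^{P_r}(u(x,\cdot),z_0(x),t),(h(x,\cdot),y(x))\rangle$$ defines a measurable function from $\Omega\times[a,b]$ to $\mathbb{R}$.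
   Context: Fix $a<b$, $r>0$. $\mathcal{M}(\Omega;E)$ is the set of measurable functions from $\Omega$ to the metric space $E$ (Borel sigma algebra); for $u\in\mathcal{M}(\Omega;C[a,b])$ write $u(x,\cdot)\in C[a,b]$ for its value at $x$. $\mathcal{L}(A;B)$ is the space of continuous linear maps. $\operatorname{osc}_I(u)=\sup_{s,t\in I}|u(t)-u(s)|$. "Measurable" means Borel measurable on topological spaces; duals such as $C(I)^*$ and $(C[a,b]\times\mathbb{R})^*$ carry the weak-star topology; $\Omega\times[a,b]$ carries the product sigma algebra. $\pi_r(z)=\max\{-r,\min\{r,z\}\}$. Interval objects. For a compact interval $I=[t_*,t^*]\subset[a,b]$ and $u\in C(I)$, $t\in I$: $(F^Iu)(t)=\max_{s\in I,s\le t}u(s)$; $M^I(u,t)=\{s\in I:s\le t,\ u(s)=(F^Iu)(t)\}$; $\Phi^I(u,t)=\{\nu\in C(I)^*:\operatorname{supp}\nu\subset M^I(u,t),\ \nu\ge0,\ \|\nu\|=1\}$. $S_\Phi^I$ is the set of all measurable selectors $\mu:C(I)\times I\to C(I)^*$ of $\Phi^I$, i.e. $\mu$ measurable with $\mu(u,t)\in\Phi^I(u,t)$. $S_H$ is the set of functions $\lambda_H:\mathbb{R}\to[0,1]$ with $\lambda_H(x)=0$ for $x<0$, $\lambda_H(x)=1$ for $x>0$, $\lambda_H(0)\in\mathbb{Q}\cap[0,1]$. Let $Z^I=\{(u,p)\in C(I)\times\mathbb{R}:\operatorname{osc}_I u<r\}$; with $w_+=\max\{p,F^I(u-r)\}$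 and $w_-=\min\{p,-F^I(-u-r)\}$ (pointwise in $t$) let $Z^I_+=\{(u,p)\in Z^I:u-w_+>-r\text{ on }I\}$, $Z^I_-=\{(u,p)\in Z^I:u-w_-<r\text{ on }I\}$. One has $Z^I=Z^I_+\cup Z^I_-$, and $w_+=w_-=p$ on $Z_+^I\cap Z_-^I$; set $P^I(u,p)=w_\pm$ if $(u,p)\in Z^I_\pm$. $S^I$ is the set of all $\nu:Z^I\times I\to(C(I)\times\mathbb{R})^*$ of the form $\langle\nu(u,p,t),(h,\eta)\rangle=\eta+\lambda^+(F^I(u-p-r)(t))\,\langle\mu^+(u,t),h-\eta\rangle$ if $(u,p)\in Z^I_+$, and $\langle\nu(u,p,t),(h,\eta)\rangle=\eta+\lambda^-(F^I(-u+p-r)(t))\,\langle\mu^-(-u,t),h-\eta\rangle$ if $(u,p)\in Z^I_-$, with $\lambda^\pm\in S_H$, $\mu^\pm\in S^I_\Phi$ (both expressions equal $\eta$ on $Z^I_+\cap Z^I_-$; real numbers are identified with constant functions). Partition objects. For a partition $\Delta=\{t_k\}$, $a=t_0<\dots<t_N=b$, let $I_k=[t_{k-1},t_k]$, $|\Delta|=\max_k(t_k-t_{k-1})$ and $Z^\Delta=\{(u,z_0)\in C[a,b]\times\mathbb{R}:\operatorname{osc}_{I_k}(u)<r\text{ for all }k\}$. On $Z^\Delta$ set $w_0^\Delta(u,z_0)=u(a)-\pi_r(z_0)$ and $w_k^\Delta(u,z_0)=P^{I_k}(u|_{I_k},w_{k-1}^\Delta(u,z_0))(t_k)$. $S_R$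 is the set of functions $\lambda_0:\mathbb{R}\to[0,1]$ with $\lambda_0(x)=0$ for $|x|>r$, $\lambda_0(x)=1$ for $|x|<r$, $\lambda_0(\pm r)\in\mathbb{Q}\cap[0,1]$. $S_0^\Delta$ is the set of maps $\mu_0^\Delta$ with $\langle\mu_0^\Delta(u,z_0,t_0),(h,y)\rangle=h(a)-\lambda_0(z_0)y$, $\lambda_0\in S_R$. For $k\ge1$, $S_k^\Delta$ is the set of maps $\mu_k^\Delta:Z^\Delta\times I_k\to(C[a,b]\times\mathbb{R})^*$ of the form $\langle\mu_k^\Delta(u,z_0,t),(h,y)\rangle=\big\langle\nu(u|_{I_k},w_{k-1}^\Delta(u,z_0),t),\,(h|_{I_k},\langle\mu_{k-1}^\Delta(u,z_0,t_{k-1}),(h,y)\rangle)\big\rangle$ with $\nu\in S^{I_k}$, $\mu_{k-1}^\Delta\in S_{k-1}^\Delta$. $S^\Delta$ is the set of maps $\mu^\Delta:Z^\Delta\times[a,b]\to(C[a,b]\times\mathbb{R})^*$ with $\mu^\Delta=\mu_1^\Delta$ on $Z^\Delta\times[t_0,t_1]$ and $\mu^\Delta=\mu_k^\Delta$ on $Z^\Delta\times(t_{k-1},t_k]$ for $k>1$, for some $\mu_k^\Delta\in S_k^\Delta$ ($1\le k\le N$). For $(u,z_0)\in Z^\Delta$, $G^\Delta(u,z_0)$ is the set of all operators $L^\Delta\in\mathcal{L}(C[a,b]\times\mathbb{R};L^\infty(a,b))$, $L^\Delta(h,y)(t)=\langle\mu^\Delta(u,z_0,t),(h,y)\rangle$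 on $[a,b]$, with $\mu^\Delta\in S^\Delta$. Gluing. $\{\Delta_n\}_{n\ge1}$ is a sequence of partitions with $\Delta_1=\{a,b\}$, $\Delta_{n+1}$ obtained from $\Delta_n$ by adding a single new point, and $|\Delta_n|\to0$. $0<r_1<r_2<\dots$ is a sequence with $r_n<r$. With $I_{n,k}$ the partition intervals of $\Delta_n$, $V_n=\{(u,z_0):u\in C[a,b],\ z_0\in\mathbb{R},\ \operatorname{osc}_{I_{n,k}}u<r_n\text{ for all }k\}$, so that $\overline V_n$ is given by $\operatorname{osc}_{I_{n,k}}u\le r_n$ for all $k$; $\overline V_0=\emptyset$. For $(u,z_0)\in C[a,b]\times\mathbb{R}$, $G^{P_r}(u,z_0)=G^{\Delta_n}(u,z_0)$ if $(u,z_0)\in\overline V_n\setminus\overline V_{n-1}$. (On Hölder spaces and on $W^{1,\gamma}(a,b)$, $\gamma>1$, $G^{P_r}$ is a Newton derivative of the play operator.) *)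

theory Defs
  imports "HOL-Analysis.Analysis" "HOL-Probability.Essential_Supremum"
begin

section \<open>Function spaces, duals and Borel measurability\<close>

definition borel_of :: "'a topology \<Rightarrow> 'a measure" where
  "borel_of X = sigma (topspace X) {U. openin X U}"

text \<open>The space \<open>C(I)\<close> with the maximum metric, for compact \<open>I\<close>. Its elements are extensional,
  that is, they take the value \<open>undefined\<close> outside \<open>I\<close>; restrictions \<open>u|I\<close> are therefore written
  with \<open>restrict\<close>.\<close>

abbreviation CI :: "real set \<Rightarrow> (real \<Rightarrow> real) metric" where
  "CI I \<equiv> cfunspace (top_of_set I) euclidean_metric"

text \<open>\<open>C(I) \<times> \<real>\<close>; the library's product metric is the Euclidean combination of the two metrics.\<close>

abbreviation CIR :: "real set \<Rightarrow> ((real \<Rightarrow> real) \<times> real) metric" where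
  "CIR I \<equiv> prod_metric (CI I) euclidean_metric"

text \<open>As these spaces are carriers rather than types, the vector space structure is passed around
  as the map \<open>(\<alpha>, x, \<beta>, y) \<mapsto> \<alpha> x + \<beta> y\<close>.\<close>

definition lin_real :: "real \<Rightarrow> real \<Rightarrow> real \<Rightarrow> real \<Rightarrow> real" where
  "lin_real \<alpha> x \<beta> y = \<alpha> * x + \<beta> * y"

definition lin_CI :: "real set \<Rightarrow> real \<Rightarrow> (real \<Rightarrow> real) \<Rightarrow> real \<Rightarrow> (real \<Rightarrow> real) \<Rightarrow> (real \<Rightarrow> real)" where
  "lin_CI I \<alpha> f \<beta> g = (\<lambda>t\<in>I. \<alpha> * f t + \<beta> * g t)"

definition lin_CIR ::
  "real set \<Rightarrow> real \<Rightarrow> (real \<Rightarrow> real) \<times> real \<Rightarrow> real \<Rightarrow> (real \<Rightarrow> real) \<times> real \<Rightarrow> (real \<Rightarrow> real) \<times> real" where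
  "lin_CIR I \<alpha> p \<beta> q = (lin_CI I \<alpha> (fst p) \<beta> (fst q), \<alpha> * snd p + \<beta> * snd q)"

definition cont_linear_maps ::
  "'a metric \<Rightarrow> (real \<Rightarrow> 'a \<Rightarrow> real \<Rightarrow> 'a \<Rightarrow> 'a) \<Rightarrow> 'b metric \<Rightarrow> (real \<Rightarrow> 'b \<Rightarrow> real \<Rightarrow> 'b \<Rightarrow> 'b) \<Rightarrow> ('a \<Rightarrow> 'b) set"
  where
  "cont_linear_maps X linX Y linY =
     {T \<in> extensional (mspace X).
        continuous_map (mtopology_of X) (mtopology_of Y) T \<and>
        (\<forall>p\<in>mspace X. \<forall>q\<in>mspace X. \<forall>\<alpha> \<beta>. T (linX \<alpha> p \<beta> q) = linY \<alpha> (T p) \<beta> (T q))}"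

definition dual_CI :: "real set \<Rightarrow> ((real \<Rightarrow> real) \<Rightarrow> real) set" where
  "dual_CI I = cont_linear_maps (CI I) (lin_CI I) euclidean_metric lin_real"

definition dual_CIR :: "real set \<Rightarrow> ((real \<Rightarrow> real) \<times> real \<Rightarrow> real) set" where
  "dual_CIR I = cont_linear_maps (CIR I) (lin_CIR I) euclidean_metric lin_real"

definition weak_star_CI :: "real set \<Rightarrow> ((real \<Rightarrow> real) \<Rightarrow> real) topology" where
  "weak_star_CI I =
     subtopology (product_topology (\<lambda>_. euclideanreal) (mspace (CI I))) (dual_CI I)"

definition dual_norm :: "real set \<Rightarrow> ((real \<Rightarrow> real) \<Rightarrow> real) \<Rightarrow> real" where
  "dual_norm I \<nu> = (SUP h\<in>{h \<in> mspace (CI I). \<forall>s\<in>I. \<bar>h s\<bar> \<le> 1}. \<bar>\<nu> h\<bar>)"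

text \<open>The support of (the measure represented by) \<open>\<nu> \<in> C(I)*\<close>: the complement in \<open>I\<close> of the largest
  relatively open set on which \<open>\<nu>\<close> vanishes.\<close>

definition dual_supp :: "real set \<Rightarrow> ((real \<Rightarrow> real) \<Rightarrow> real) \<Rightarrow> real set" where
  "dual_supp I \<nu> =
     {s \<in> I. \<forall>U. open U \<and> s \<in> U \<longrightarrow> (\<exists>h\<in>mspace (CI I). (\<forall>x\<in>I - U. h x = 0) \<and> \<nu> h \<noteq> 0)}"

section \<open>The space of essentially bounded functions\<close>

text \<open>Elements are equivalence classes modulo equality almost everywhere. For complete \<open>M\<close> (as used
  below), \<open>Linf_class M f\<close> is empty if \<open>f\<close> is not measurable, so it is then not in \<open>Linf_space M\<close>.\<close>

definition Linf_class :: "'a measure \<Rightarrow> ('a \<Rightarrow> real) \<Rightarrow> ('a \<Rightarrow> real) set" where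
  "Linf_class M f = {g \<in> borel_measurable M. AE t in M. g t = f t}"

definition Linf_space :: "'a measure \<Rightarrow> ('a \<Rightarrow> real) set set" where
  "Linf_space M =
     {Linf_class M f | f. f \<in> borel_measurable M \<and> esssup M (\<lambda>t. ereal \<bar>f t\<bar>) < \<infinity>}"

definition Linf_dist :: "'a measure \<Rightarrow> ('a \<Rightarrow> real) set \<Rightarrow> ('a \<Rightarrow> real) set \<Rightarrow> real" where
  "Linf_dist M A B =
     real_of_ereal (esssup M (\<lambda>t. ereal \<bar>(SOME f. f \<in> A) t - (SOME g. g \<in> B) t\<bar>))"

definition Linf_metric :: "'a measure \<Rightarrow> ('a \<Rightarrow> real) set metric" where
  "Linf_metric M = metric (Linf_space M, Linf_dist M)"

definition lin_Linf ::
  "'a measure \<Rightarrow> real \<Rightarrow> ('a \<Rightarrow> real) set \<Rightarrow> real \<Rightarrow> ('a \<Rightarrow> real) set \<Rightarrow> ('a \<Rightarrow> real) set" where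
  "lin_Linf M \<alpha> A \<beta> B = (\<Union>f\<in>A. \<Union>g\<in>B. Linf_class M (\<lambda>t. \<alpha> * f t + \<beta> * g t))"

lemma Linf_dist_eq:
  assumes "A \<in> Linf_space M" "B \<in> Linf_space M" "f \<in> A" "g \<in> B"
  shows "Linf_dist M A B = real_of_ereal (esssup M (\<lambda>t. ereal \<bar>f t - g t\<bar>))"
proof -
  define f' where "f' = (SOME f. f \<in> A)"
  define g' where "g' = (SOME g. g \<in> B)"
  have mem: "f' \<in> A" "g' \<in> B"
    unfolding f'_def g'_def by (fact someI[of "\<lambda>f. f \<in> A", OF assms(3)], fact someI[of "\<lambda>g. g \<in> B", OF assms(4)])
  from assms mem have [measurable]:
    "f \<in> borel_measurable M" "g \<in> borel_measurable M"
    "f' \<in> borel_measurable M" "g' \<in> borel_measurable M"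
    by (auto simp: Linf_space_def Linf_class_def)
  from assms mem have "AE t in M. f' t = f t" "AE t in M. g' t = g t"
    by (auto simp: Linf_space_def Linf_class_def)
  then have "AE t in M. ereal \<bar>f' t - g' t\<bar> = ereal \<bar>f t - g t\<bar>"
    by eventually_elim auto
  then have "esssup M (\<lambda>t. ereal \<bar>f' t - g' t\<bar>) = esssup M (\<lambda>t. ereal \<bar>f t - g t\<bar>)"
    by (intro esssup_AE_cong) auto
  then show ?thesis
    by (simp add: Linf_dist_def f'_def g'_def)
qed

lemma Linf_space_rep:
  assumes "A \<in> Linf_space M"
  obtains f C where "f \<in> A" "f \<in> borel_measurable M" "A = Linf_class M f"
    "AE t in M. \<bar>f t\<bar> \<le> C"
proof -
  from assms obtain f where f: "f \<in> borel_measurable M" "A = Linf_class M f"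
    and fin: "esssup M (\<lambda>t. ereal \<bar>f t\<bar>) < \<infinity>"
    by (auto simp: Linf_space_def)
  from fin obtain C where C: "esssup M (\<lambda>t. ereal \<bar>f t\<bar>) \<le> ereal C"
    by (cases "esssup M (\<lambda>t. ereal \<bar>f t\<bar>)") auto
  have "AE t in M. \<bar>f t\<bar> \<le> C"
    using esssup_AE[of "\<lambda>t. ereal \<bar>f t\<bar>" M]
  proof eventually_elim
    case (elim t)
    then have "ereal \<bar>f t\<bar> \<le> ereal C" using C order_trans by blast
    then show ?case by simp
  qed
  moreover have "f \<in> A" using f by (simp add: Linf_class_def)
  ultimately show thesis using f that by blast
qed

lemma real_esssup_le_iff:
  fixes f :: "'a \<Rightarrow> real"
  assumes [measurable]: "f \<in> borel_measurable M" and bd: "AE t in M. \<bar>f t\<bar> \<le> C" and "c \<ge> 0"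
  shows "real_of_ereal (esssup M (\<lambda>t. ereal \<bar>f t\<bar>)) \<le> c \<longleftrightarrow> (AE t in M. \<bar>f t\<bar> \<le> c)"
proof
  assume le: "real_of_ereal (esssup M (\<lambda>t. ereal \<bar>f t\<bar>)) \<le> c"
  have "esssup M (\<lambda>t. ereal \<bar>f t\<bar>) \<le> ereal C"
    using bd by (intro esssup_I) auto
  then have "esssup M (\<lambda>t. ereal \<bar>f t\<bar>) \<le> ereal c"
    using le by (cases "esssup M (\<lambda>t. ereal \<bar>f t\<bar>)") auto
  with esssup_AE[of "\<lambda>t. ereal \<bar>f t\<bar>" M] show "AE t in M. \<bar>f t\<bar> \<le> c"
    by (elim eventually_mono) (metis ereal_less_eq(3) order_trans)
next
  assume "AE t in M. \<bar>f t\<bar> \<le> c"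
  then have "esssup M (\<lambda>t. ereal \<bar>f t\<bar>) \<le> ereal c"
    by (intro esssup_I) auto
  with \<open>c \<ge> 0\<close> show "real_of_ereal (esssup M (\<lambda>t. ereal \<bar>f t\<bar>)) \<le> c"
    by (cases "esssup M (\<lambda>t. ereal \<bar>f t\<bar>)") auto
qed

lemma Linf_dist_nonneg: "0 \<le> Linf_dist M A B"
proof (cases "emeasure M (space M) = 0")
  case True
  let ?f = "\<lambda>t. ereal \<bar>(SOME f. f \<in> A) t - (SOME g. g \<in> B) t\<bar>"
  have "esssup M ?f = - \<infinity> \<or> esssup M ?f = \<infinity>"
    using esssup_zero_space[OF True, of ?f] esssup_non_measurable[of ?f M]
    by (metis top_ereal_def)
  then show ?thesis unfolding Linf_dist_def by fastforce
next
  case False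
  let ?f = "\<lambda>t. ereal \<bar>(SOME f. f \<in> A) t - (SOME g. g \<in> B) t\<bar>"
  have "esssup M (\<lambda>t. 0 :: ereal) \<le> esssup M ?f"
    by (rule esssup_mono) auto
  then show ?thesis
    using esssup_const[OF False, of "0 :: ereal"] by (simp add: Linf_dist_def real_of_ereal_pos)
qed

lemma Metric_space_Linf: "Metric_space (Linf_space M) (Linf_dist M)"
proof
  fix A B :: "('a \<Rightarrow> real) set"
  show "0 \<le> Linf_dist M A B" by (rule Linf_dist_nonneg)
  show "Linf_dist M A B = Linf_dist M B A"
    by (simp add: Linf_dist_def abs_minus_commute)
next
  fix A B assume A: "A \<in> Linf_space M" and B: "B \<in> Linf_space M"
  from Linf_space_rep[OF A] obtain f C where f: "f \<in> A" "f \<in> borel_measurable M"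
    "A = Linf_class M f" "AE t in M. \<bar>f t\<bar> \<le> C" by blast
  from Linf_space_rep[OF B] obtain g D where g: "g \<in> B" "g \<in> borel_measurable M"
    "B = Linf_class M g" "AE t in M. \<bar>g t\<bar> \<le> D" by blast
  have bd: "AE t in M. \<bar>f t - g t\<bar> \<le> C + D"
    using f(4) g(4) by eventually_elim auto
  have "Linf_dist M A B = 0 \<longleftrightarrow> Linf_dist M A B \<le> 0"
    using Linf_dist_nonneg[of M A B] by auto
  also have "\<dots> \<longleftrightarrow> (AE t in M. \<bar>f t - g t\<bar> \<le> 0)"
    unfolding Linf_dist_eq[OF A B f(1) g(1)]
    using f g bd by (intro real_esssup_le_iff) auto
  also have "\<dots> \<longleftrightarrow> (AE t in M. f t = g t)"
    by simp
  also have "\<dots> \<longleftrightarrow> A = B"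
  proof
    assume eq: "AE t in M. f t = g t"
    have "(AE t in M. k t = f t) \<longleftrightarrow> (AE t in M. k t = g t)" for k
      using eq by (auto elim: eventually_elim2)
    then show "A = B" by (simp add: f(3) g(3) Linf_class_def)
  next
    assume "A = B"
    then have "f \<in> Linf_class M g" using f g by simp
    then show "AE t in M. f t = g t" by (simp add: Linf_class_def)
  qed
  finally show "Linf_dist M A B = 0 \<longleftrightarrow> A = B" .
next
  fix A B E assume A: "A \<in> Linf_space M" and B: "B \<in> Linf_space M" and E: "E \<in> Linf_space M"
  from Linf_space_rep[OF A] obtain f C where f: "f \<in> A" "f \<in> borel_measurable M"
    "AE t in M. \<bar>f t\<bar> \<le> C" by blast
  from Linf_space_rep[OF B] obtain g D where g: "g \<in> B" "g \<in> borel_measurable M"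
    "AE t in M. \<bar>g t\<bar> \<le> D" by blast
  from Linf_space_rep[OF E] obtain k K where k: "k \<in> E" "k \<in> borel_measurable M"
    "AE t in M. \<bar>k t\<bar> \<le> K" by blast
  have fg: "AE t in M. \<bar>f t - g t\<bar> \<le> C + D" using f(3) g(3) by eventually_elim auto
  have gk: "AE t in M. \<bar>g t - k t\<bar> \<le> D + K" using g(3) k(3) by eventually_elim auto
  have fk: "AE t in M. \<bar>f t - k t\<bar> \<le> C + K" using f(3) k(3) by eventually_elim auto
  have "AE t in M. \<bar>f t - g t\<bar> \<le> Linf_dist M A B"
    using f g fg Linf_dist_nonneg[of M A B] Linf_dist_eq[OF A B f(1) g(1)]
    by (subst real_esssup_le_iff[symmetric]) auto
  moreover have "AE t in M. \<bar>g t - k t\<bar> \<le> Linf_dist M B E"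
    using g k gk Linf_dist_nonneg[of M B E] Linf_dist_eq[OF B E g(1) k(1)]
    by (subst real_esssup_le_iff[symmetric]) auto
  ultimately have "AE t in M. \<bar>f t - k t\<bar> \<le> Linf_dist M A B + Linf_dist M B E"
    by eventually_elim auto
  then show "Linf_dist M A E \<le> Linf_dist M A B + Linf_dist M B E"
    unfolding Linf_dist_eq[OF A E f(1) k(1)]
    using f k fk Linf_dist_nonneg[of M A B] Linf_dist_nonneg[of M B E]
    by (subst real_esssup_le_iff) auto
qed

lemma mspace_Linf_metric [simp]: "mspace (Linf_metric M) = Linf_space M"
  by (simp add: Linf_metric_def Metric_space.mspace_metric[OF Metric_space_Linf])

lemma mdist_Linf_metric [simp]: "mdist (Linf_metric M) = Linf_dist M"
  by (simp add: Linf_metric_def Metric_space.mdist_metric[OF Metric_space_Linf])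

abbreviation leb_ab :: "real \<Rightarrow> real \<Rightarrow> real measure" where
  "leb_ab a b \<equiv> lebesgue_on {a<..<b}"

definition ops_CR_Linf :: "real \<Rightarrow> real \<Rightarrow> ((real \<Rightarrow> real) \<times> real \<Rightarrow> (real \<Rightarrow> real) set) set" where
  "ops_CR_Linf a b =
     cont_linear_maps (CIR {a..b}) (lin_CIR {a..b}) (Linf_metric (leb_ab a b)) (lin_Linf (leb_ab a b))"

section \<open>Objects on a single interval\<close>

definition osc :: "real set \<Rightarrow> (real \<Rightarrow> real) \<Rightarrow> real" where
  "osc I u = (SUP p\<in>I \<times> I. \<bar>u (snd p) - u (fst p)\<bar>)"

definition proj :: "real \<Rightarrow> real \<Rightarrow> real" where
  "proj r z = max (- r) (min r z)"

definition cummax :: "real set \<Rightarrow> (real \<Rightarrow> real) \<Rightarrow> real \<Rightarrow> real" where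
  "cummax I u t = (SUP s\<in>{s \<in> I. s \<le> t}. u s)"

definition argmax_set :: "real set \<Rightarrow> (real \<Rightarrow> real) \<Rightarrow> real \<Rightarrow> real set" where
  "argmax_set I u t = {s \<in> I. s \<le> t \<and> u s = cummax I u t}"

definition Phi :: "real set \<Rightarrow> (real \<Rightarrow> real) \<Rightarrow> real \<Rightarrow> ((real \<Rightarrow> real) \<Rightarrow> real) set" where
  "Phi I u t =
     {\<nu> \<in> dual_CI I. dual_supp I \<nu> \<subseteq> argmax_set I u t \<and>
        (\<forall>h\<in>mspace (CI I). (\<forall>s\<in>I. 0 \<le> h s) \<longrightarrow> 0 \<le> \<nu> h) \<and>
        dual_norm I \<nu> = 1}"

definition S_Phi :: "real set \<Rightarrow> ((real \<Rightarrow> real) \<Rightarrow> real \<Rightarrow> ((real \<Rightarrow> real) \<Rightarrow> real)) set" where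
  "S_Phi I =
     {\<mu>. (\<lambda>(u, t). \<mu> u t) \<in>
            measurable (borel_of (prod_topology (mtopology_of (CI I)) (top_of_set I)))
                       (borel_of (weak_star_CI I)) \<and>
          (\<forall>u\<in>mspace (CI I). \<forall>t\<in>I. \<mu> u t \<in> Phi I u t)}"

definition S_H :: "(real \<Rightarrow> real) set" where
  "S_H = {l. (\<forall>x. 0 \<le> l x \<and> l x \<le> 1) \<and> (\<forall>x<0. l x = 0) \<and> (\<forall>x>0. l x = 1) \<and> l 0 \<in> \<rat>}"

definition Z_I :: "real \<Rightarrow> real set \<Rightarrow> ((real \<Rightarrow> real) \<times> real) set" where
  "Z_I r I = {(u, p). u \<in> mspace (CI I) \<and> osc I u < r}"

definition w_plus :: "real \<Rightarrow> real set \<Rightarrow> (real \<Rightarrow> real) \<Rightarrow> real \<Rightarrow> real \<Rightarrow> real" where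
  "w_plus r I u p t = max p (cummax I (\<lambda>s. u s - r) t)"

definition w_minus :: "real \<Rightarrow> real set \<Rightarrow> (real \<Rightarrow> real) \<Rightarrow> real \<Rightarrow> real \<Rightarrow> real" where
  "w_minus r I u p t = min p (- cummax I (\<lambda>s. - u s - r) t)"

definition Z_plus :: "real \<Rightarrow> real set \<Rightarrow> ((real \<Rightarrow> real) \<times> real) set" where
  "Z_plus r I = {(u, p) \<in> Z_I r I. \<forall>t\<in>I. u t - w_plus r I u p t > - r}"

definition Z_minus :: "real \<Rightarrow> real set \<Rightarrow> ((real \<Rightarrow> real) \<times> real) set" where
  "Z_minus r I = {(u, p) \<in> Z_I r I. \<forall>t\<in>I. u t - w_minus r I u p t < r}"

text \<open>\<open>Z_I\<close> is the union of \<open>Z_plus\<close> and \<open>Z_minus\<close>, and \<open>w_plus = w_minus\<close> on their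
  intersection, so the order of the case distinction is immaterial.\<close>

definition P_I :: "real \<Rightarrow> real set \<Rightarrow> (real \<Rightarrow> real) \<Rightarrow> real \<Rightarrow> real \<Rightarrow> real" where
  "P_I r I u p = (if (u, p) \<in> Z_plus r I then w_plus r I u p else w_minus r I u p)"

definition S_I ::
  "real \<Rightarrow> real set \<Rightarrow> ((real \<Rightarrow> real) \<Rightarrow> real \<Rightarrow> real \<Rightarrow> ((real \<Rightarrow> real) \<times> real \<Rightarrow> real)) set" where
  "S_I r I =
     {\<nu>. (\<forall>(u, p)\<in>Z_I r I. \<forall>t\<in>I. \<nu> u p t \<in> dual_CIR I) \<and>
          (\<exists>lp\<in>S_H. \<exists>lm\<in>S_H. \<exists>mp\<in>S_Phi I. \<exists>mm\<in>S_Phi I.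
             (\<forall>(u, p)\<in>Z_plus r I. \<forall>t\<in>I. \<forall>h\<in>mspace (CI I). \<forall>\<eta>.
                \<nu> u p t (h, \<eta>) =
                  \<eta> + lp (cummax I (\<lambda>s. u s - p - r) t) * mp u t (\<lambda>s\<in>I. h s - \<eta>)) \<and>
             (\<forall>(u, p)\<in>Z_minus r I. \<forall>t\<in>I. \<forall>h\<in>mspace (CI I). \<forall>\<eta>.
                \<nu> u p t (h, \<eta>) =
                  \<eta> + lm (cummax I (\<lambda>s. - u s + p - r) t) * mm (\<lambda>s\<in>I. - u s) t (\<lambda>s\<in>I. h s - \<eta>)))}"

section \<open>Objects attached to a partition\<close>

text \<open>A partition \<open>a = t\<^sub>0 < \<dots> < t\<^sub>N = b\<close> is the list \<open>[t\<^sub>0, \<dots>, t\<^sub>N]\<close>; thus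
  \<open>t\<^sub>k = D ! k\<close> and \<open>N = length D - 1\<close>.\<close>

definition is_partition :: "real \<Rightarrow> real \<Rightarrow> real list \<Rightarrow> bool" where
  "is_partition a b D \<longleftrightarrow> length D \<ge> 2 \<and> sorted_wrt (<) D \<and> hd D = a \<and> last D = b"

definition pint :: "real list \<Rightarrow> nat \<Rightarrow> real set" where
  "pint D k = {D ! (k - 1)..D ! k}"

definition mesh :: "real list \<Rightarrow> real" where
  "mesh D = Max ((\<lambda>k. D ! k - D ! (k - 1)) ` {1..<length D})"

definition Z_D :: "real \<Rightarrow> real \<Rightarrow> real \<Rightarrow> real list \<Rightarrow> ((real \<Rightarrow> real) \<times> real) set" where
  "Z_D a b r D =
     {(u, z0). u \<in> mspace (CI {a..b}) \<and> (\<forall>k\<in>{1..<length D}. osc (pint D k) u < r)}"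

primrec w_D :: "real \<Rightarrow> real list \<Rightarrow> nat \<Rightarrow> (real \<Rightarrow> real) \<Rightarrow> real \<Rightarrow> real" where
  "w_D r D 0 u z0 = u (D ! 0) - proj r z0"
| "w_D r D (Suc k) u z0 =
     P_I r (pint D (Suc k)) (restrict u (pint D (Suc k))) (w_D r D k u z0) (D ! Suc k)"

definition S_R :: "real \<Rightarrow> (real \<Rightarrow> real) set" where
  "S_R r = {l. (\<forall>x. 0 \<le> l x \<and> l x \<le> 1) \<and> (\<forall>x. \<bar>x\<bar> > r \<longrightarrow> l x = 0) \<and>
               (\<forall>x. \<bar>x\<bar> < r \<longrightarrow> l x = 1) \<and> l r \<in> \<rat> \<and> l (- r) \<in> \<rat>}"

text \<open>The elements of \<open>S_k a b r D k\<close> matter only on \<open>Z_D a b r D \<times> pint D k\<close>, those for \<open>k = 0\<close>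
  only on \<open>Z_D a b r D \<times> {t\<^sub>0}\<close>.\<close>

primrec S_k ::
  "real \<Rightarrow> real \<Rightarrow> real \<Rightarrow> real list \<Rightarrow> nat \<Rightarrow>
    ((real \<Rightarrow> real) \<Rightarrow> real \<Rightarrow> real \<Rightarrow> ((real \<Rightarrow> real) \<times> real \<Rightarrow> real)) set" where
  "S_k a b r D 0 =
     {\<mu>. \<exists>l0\<in>S_R r. \<forall>(u, z0)\<in>Z_D a b r D.
          \<mu> u z0 (D ! 0) \<in> dual_CIR {a..b} \<and>
          (\<forall>h\<in>mspace (CI {a..b}). \<forall>y. \<mu> u z0 (D ! 0) (h, y) = h a - l0 z0 * y)}"
| "S_k a b r D (Suc k) =
     {\<mu>. \<exists>\<nu>\<in>S_I r (pint D (Suc k)). \<exists>\<mu>'\<in>S_k a b r D k.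
          \<forall>(u, z0)\<in>Z_D a b r D. \<forall>t\<in>pint D (Suc k).
            \<mu> u z0 t \<in> dual_CIR {a..b} \<and>
            (\<forall>h\<in>mspace (CI {a..b}). \<forall>y.
               \<mu> u z0 t (h, y) =
                 \<nu> (restrict u (pint D (Suc k))) (w_D r D k u z0) t
                   (restrict h (pint D (Suc k)), \<mu>' u z0 (D ! k) (h, y)))}"

definition S_D ::
  "real \<Rightarrow> real \<Rightarrow> real \<Rightarrow> real list \<Rightarrow>
    ((real \<Rightarrow> real) \<Rightarrow> real \<Rightarrow> real \<Rightarrow> ((real \<Rightarrow> real) \<times> real \<Rightarrow> real)) set" where
  "S_D a b r D =
     {\<mu>. \<exists>m. (\<forall>k\<in>{1..<length D}. m k \<in> S_k a b r D k) \<and>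
          (\<forall>(u, z0)\<in>Z_D a b r D.
             (\<forall>t\<in>{D ! 0..D ! 1}. \<mu> u z0 t = m 1 u z0 t) \<and>
             (\<forall>k\<in>{2..<length D}. \<forall>t\<in>{D ! (k - 1)<..D ! k}. \<mu> u z0 t = m k u z0 t))}"

text \<open>The operator \<open>(h, y) \<mapsto> (t \<mapsto> \<langle>\<phi> t, (h, y)\<rangle>)\<close>, each value being the class
  of the pointwise defined function. Membership in \<open>ops_CR_Linf\<close> is not built in.\<close>

definition op_of ::
  "real \<Rightarrow> real \<Rightarrow> (real \<Rightarrow> ((real \<Rightarrow> real) \<times> real \<Rightarrow> real)) \<Rightarrow>
    ((real \<Rightarrow> real) \<times> real \<Rightarrow> (real \<Rightarrow> real) set)" where
  "op_of a b \<phi> = (\<lambda>q\<in>mspace (CIR {a..b}). Linf_class (leb_ab a b) (\<lambda>t. \<phi> t q))"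

definition G_D ::
  "real \<Rightarrow> real \<Rightarrow> real \<Rightarrow> real list \<Rightarrow> (real \<Rightarrow> real) \<Rightarrow> real \<Rightarrow>
    ((real \<Rightarrow> real) \<times> real \<Rightarrow> (real \<Rightarrow> real) set) set" where
  "G_D a b r D u z0 = {L \<in> ops_CR_Linf a b. \<exists>\<mu>\<in>S_D a b r D. L = op_of a b (\<mu> u z0)}"

section \<open>Gluing along a sequence of partitions\<close>

text \<open>The sequences are indexed by \<open>n \<ge> 1\<close>; the value at \<open>0\<close> is irrelevant.\<close>

definition admissible_partitions :: "real \<Rightarrow> real \<Rightarrow> (nat \<Rightarrow> real list) \<Rightarrow> bool" where
  "admissible_partitions a b Ds \<longleftrightarrow>
     (\<forall>n\<ge>1. is_partition a b (Ds n)) \<and> Ds 1 = [a, b] \<and>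
     (\<forall>n\<ge>1. \<exists>p. p \<notin> set (Ds n) \<and> set (Ds (Suc n)) = insert p (set (Ds n))) \<and>
     (\<lambda>n. mesh (Ds n)) \<longlonglongrightarrow> 0"

definition admissible_radii :: "real \<Rightarrow> (nat \<Rightarrow> real) \<Rightarrow> bool" where
  "admissible_radii r rs \<longleftrightarrow> 0 < rs 1 \<and> (\<forall>n\<ge>1. rs n < rs (Suc n)) \<and> (\<forall>n\<ge>1. rs n < r)"

definition V :: "real \<Rightarrow> real \<Rightarrow> (nat \<Rightarrow> real list) \<Rightarrow> (nat \<Rightarrow> real) \<Rightarrow> nat \<Rightarrow> ((real \<Rightarrow> real) \<times> real) set" where
  "V a b Ds rs n = Z_D a b (rs n) (Ds n)"

definition Vbar :: "real \<Rightarrow> real \<Rightarrow> (nat \<Rightarrow> real list) \<Rightarrow> (nat \<Rightarrow> real) \<Rightarrow> nat \<Rightarrow> ((real \<Rightarrow> real) \<times> real) set" where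
  "Vbar a b Ds rs n = (if n = 0 then {} else mtopology_of (CIR {a..b}) closure_of V a b Ds rs n)"

text \<open>The layers \<open>Vbar n - Vbar (n - 1)\<close>, \<open>n \<ge> 1\<close>, are disjoint and cover \<open>C[a,b] \<times> \<real>\<close>.\<close>

definition G_P ::
  "real \<Rightarrow> real \<Rightarrow> real \<Rightarrow> (nat \<Rightarrow> real list) \<Rightarrow> (nat \<Rightarrow> real) \<Rightarrow> (real \<Rightarrow> real) \<Rightarrow> real \<Rightarrow>
    ((real \<Rightarrow> real) \<times> real \<Rightarrow> (real \<Rightarrow> real) set) set" where
  "G_P a b r Ds rs u z0 =
     {L. \<exists>n\<ge>1. (u, z0) \<in> Vbar a b Ds rs n - Vbar a b Ds rs (n - 1) \<and> L \<in> G_D a b r (Ds n) u z0}"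

end

theory Submission
  imports Defs
begin

text \<open>All functions involved are compositions of jointly measurable ones. A measurable selector
  \<open>\<mu>\<close> of \<open>\<Phi>\<close> composed with measurable arguments is weak-star measurable, and pairing it with a
  varying \<open>h\<close> stays measurable because \<open>h\<close> is the uniform limit of its Bernstein polynomials while
  \<open>\<mu>\<close> has norm one. An element of \<open>S\<^sup>I\<close> maps \<open>(h, \<eta>)\<close> to a convex combination of \<open>\<eta>\<close> and
  \<open>\<langle>\<mu>, h\<rangle>\<close>, so measurability and the bound \<open>\<parallel>h\<parallel> + \<bar>y\<bar>\<close> propagate along a partition. Finally,
  \<open>C[a,b] \<times> \<real>\<close> is the countable union of the Borel layers, and \<open>osc u \<le> r\<^sub>n < r\<close> on the intervals of
  \<open>\<Delta>\<^sub>n\<close> puts the \<open>n\<close>-th layer inside the domain of \<open>\<mu>\<close> for \<open>\<Delta>\<^sub>n\<close>.\<close>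

section \<open>Measurable maps into spaces of continuous functions\<close>

text \<open>A product topology can have more Borel sets than the product sigma algebra, and
  \<open>S_Phi\<close> asks for measurability with respect to the former. What makes pairing work is
  that the time (or real) factor is second countable; separability of \<open>C(I)\<close> is not
  invoked. Elements of \<open>S_I\<close>, \<open>S_k\<close> and \<open>S_D\<close> carry no
  measurability of their own: formulas prescribe them on their domains only. Each formula is
  therefore rewritten until its ingredients are visibly measurable; in particular the cases
  \<open>Z_plus\<close> and \<open>Z_minus\<close>, which quantify over all times, become
  comparisons of \<open>p\<close> with extrema of \<open>u\<close>.

  The lemmas concern an arbitrary measurable space \<open>M\<close> on which every argument,
  including the time, is a measurable map. This allows \<open>M\<close> to be restricted to the
  preimage of a piece or a layer, and it lets \<open>measurable_layers\<close> serve twice: on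
  \<open>\<Omega>\<close> times \<open>[a,b]\<close> for joint measurability, and on
  \<open>(a,b)\<close> with all but the time frozen, where it provides the classes that
  \<open>L x\<close> takes as values. The bound, being uniform in time, turns the family of
  functionals into one continuous operator.\<close>

declare mspace_cfunspace [simp del]

text \<open>The carrier of a function space consists of bounded continuous functions; compactness
  makes boundedness automatic.\<close>

lemma mspace_CI:
  assumes "compact I"
  shows "f \<in> mspace (CI I) \<longleftrightarrow> f \<in> extensional I \<and> continuous_on I f"
proof -
  have "compactin (top_of_set I) (topspace (top_of_set I))"
    using assms by (simp add: compactin_subtopology)
  from compactin_mspace_cfunspace[OF this] show ?thesis by auto
qed

lemma restrict_in_CI:
  assumes "compact I" "continuous_on I f"
  shows "restrict f I \<in> mspace (CI I)"
  using assms by (simp add: mspace_CI)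

lemma CI_continuous_on: "compact I \<Longrightarrow> f \<in> mspace (CI I) \<Longrightarrow> J \<subseteq> I \<Longrightarrow> continuous_on J f"
  using continuous_on_subset mspace_CI by blast

lemma CI_dist_le:
  assumes "f \<in> mspace (CI I)" "g \<in> mspace (CI I)" "s \<in> I"
  shows "\<bar>f s - g s\<bar> \<le> mdist (CI I) f g"
  using mdist_cfunspace_imp_mdist_le[OF assms(1,2) order_refl, of s] assms(3)
  by (simp add: dist_real_def)

lemma CI_dist_leI:
  assumes "0 \<le> B" "\<And>s. s \<in> I \<Longrightarrow> \<bar>f s - g s\<bar> \<le> B"
  shows "mdist (CI I) f g \<le> B"
  using assms by (intro mdist_cfunspace_le) (auto simp: dist_real_def)

section \<open>Borel measurability relative to a topology\<close>

lemma space_borel_of [simp]: "space (borel_of X) = topspace X"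
  unfolding borel_of_def by (rule space_measure_of) (auto dest: openin_subset)

lemma sets_borel_of: "sets (borel_of X) = sigma_sets (topspace X) {U. openin X U}"
  unfolding borel_of_def by (rule sets_measure_of) (auto dest: openin_subset)

lemma measurable_borel_of_iff:
  "f \<in> measurable M (borel_of X) \<longleftrightarrow>
     f \<in> space M \<rightarrow> topspace X \<and> (\<forall>U. openin X U \<longrightarrow> f -` U \<inter> space M \<in> sets M)"
proof -
  have *: "{U. openin X U} \<subseteq> Pow (topspace X)" by (auto dest: openin_subset)
  show ?thesis
  proof
    assume f: "f \<in> measurable M (borel_of X)"
    then have "f -` U \<inter> space M \<in> sets M" if "openin X U" for U
      using that by (intro measurable_sets[OF f]) (auto simp: sets_borel_of)
    with measurable_space[OF f] show "f \<in> space M \<rightarrow> topspace X \<and> (\<forall>U. openin X U \<longrightarrow> f -` U \<inter> space M \<in> sets M)"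
      by auto
  next
    assume "f \<in> space M \<rightarrow> topspace X \<and> (\<forall>U. openin X U \<longrightarrow> f -` U \<inter> space M \<in> sets M)"
    then show "f \<in> measurable M (borel_of X)"
      unfolding borel_of_def by (intro measurable_measure_of[OF *]) auto
  qed
qed

lemma closedin_borel_of: "closedin X S \<Longrightarrow> S \<in> sets (borel_of X)"
  unfolding closedin_def sets_borel_of
  by (metis (no_types) double_diff mem_Collect_eq sigma_sets.Basic sigma_sets.Compl subset_refl)

lemma measurable_compose_continuous_map:
  assumes "f \<in> measurable M (borel_of X)" "continuous_map X Y g"
  shows "(\<lambda>x. g (f x)) \<in> measurable M (borel_of Y)"
proof -
  have "g \<in> measurable (borel_of X) (borel_of Y)"
    using assms(2)
    by (auto simp: measurable_borel_of_iff continuous_map_def sets_borel_of vimage_def Int_def conj_commute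
        intro!: sigma_sets.Basic)
  with assms(1) show ?thesis by (rule measurable_compose)
qed

lemma borel_of_euclidean [simp]: "borel_of euclidean = borel"
  by (simp add: borel_of_def borel_def)

lemma measurable_CI_space:
  "f \<in> measurable M (borel_of (mtopology_of (CI I))) \<Longrightarrow> x \<in> space M \<Longrightarrow> f x \<in> mspace (CI I)"
  by (drule (1) measurable_space) simp

text \<open>Only one factor has to be second countable: an open set is a union of rectangles
  \<open>W B \<times> B\<close> over countably many \<open>B\<close>, with \<open>W B\<close> the union of all admissible first sides.\<close>

lemma measurable_Pair_borel_of:
  fixes g :: "'a \<Rightarrow> 'b::second_countable_topology"
  assumes f: "f \<in> measurable M (borel_of X)" and g: "g \<in> borel_measurable M"
    and S: "\<And>x. x \<in> space M \<Longrightarrow> g x \<in> S"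
  shows "(\<lambda>x. (f x, g x)) \<in> measurable M (borel_of (prod_topology X (top_of_set S)))"
  unfolding measurable_borel_of_iff
proof (intro conjI allI impI)
  show "(\<lambda>x. (f x, g x)) \<in> space M \<rightarrow> topspace (prod_topology X (top_of_set S))"
    using measurable_space[OF f] S by auto
  fix U assume U: "openin (prod_topology X (top_of_set S)) U"
  obtain \<B> :: "'b set set" where \<B>: "countable \<B>" "topological_basis \<B>"
    using ex_countable_basis by blast
  define W where "W B = \<Union>{W. openin X W \<and> W \<times> (B \<inter> S) \<subseteq> U}" for B
  have W: "openin X (W B)" for B unfolding W_def by auto
  have eq: "(\<lambda>x. (f x, g x)) -` U \<inter> space M = (\<Union>B\<in>\<B>. (f -` W B \<inter> space M) \<inter> (g -` B \<inter> space M))"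
  proof (intro equalityI subsetI)
    fix x assume x: "x \<in> (\<lambda>x. (f x, g x)) -` U \<inter> space M"
    then have "(f x, g x) \<in> U" by simp
    then obtain P Q where PQ: "openin X P" "openin (top_of_set S) Q" "f x \<in> P" "g x \<in> Q" "P \<times> Q \<subseteq> U"
      using U unfolding openin_prod_topology_alt by meson
    then obtain T where T: "open T" "Q = S \<inter> T" by (auto simp: openin_open)
    then obtain B where "B \<in> \<B>" "g x \<in> B" "B \<subseteq> T"
      using PQ topological_basisE[OF \<B>(2)] by (metis IntE)
    moreover have "P \<times> (B \<inter> S) \<subseteq> U" using PQ T \<open>B \<subseteq> T\<close> by blast
    then have "f x \<in> W B" unfolding W_def using PQ by blast
    ultimately show "x \<in> (\<Union>B\<in>\<B>. (f -` W B \<inter> space M) \<inter> (g -` B \<inter> space M))" using x by blast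
  next
    fix x assume "x \<in> (\<Union>B\<in>\<B>. (f -` W B \<inter> space M) \<inter> (g -` B \<inter> space M))"
    then obtain B P where "x \<in> space M" "f x \<in> P" "g x \<in> B" "P \<times> (B \<inter> S) \<subseteq> U"
      unfolding W_def by blast
    then show "x \<in> (\<lambda>x. (f x, g x)) -` U \<inter> space M" using S[of x] by blast
  qed
  have "f -` W B \<inter> space M \<in> sets M" for B using f W by (auto simp: measurable_borel_of_iff)
  moreover have "g -` B \<inter> space M \<in> sets M" if "B \<in> \<B>" for B
    using g topological_basis_open[OF \<B>(2) that] by (simp add: measurable_sets)
  ultimately show "(\<lambda>x. (f x, g x)) -` U \<inter> space M \<in> sets M"
    unfolding eq using \<B>(1) by (intro sets.countable_UN' sets.Int) auto
qed

text \<open>The difference \<open>g s - f t\<close> splits through \<open>f s\<close>: the uniform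
  distance of \<open>g\<close> and \<open>f\<close> and the continuity of the single function
  \<open>f\<close> contribute less than \<open>e/2\<close> each.\<close>

lemma continuous_map_CI_eval:
  assumes "compact I"
  shows "continuous_map (prod_topology (mtopology_of (CI I)) (top_of_set I)) euclideanreal (\<lambda>(f, t). f t)"
proof -
  interpret C: Metric_space "mspace (CI I)" "mdist (CI I)" by simp
  have "openin (prod_topology (mtopology_of (CI I)) (top_of_set I))
     {x \<in> topspace (prod_topology (mtopology_of (CI I)) (top_of_set I)). (\<lambda>(f, t). f t) x \<in> U}"
    if "openin euclidean U" for U :: "real set"
  proof -
    from that have "open U" by simp
    let ?P = "{x \<in> topspace (prod_topology (mtopology_of (CI I)) (top_of_set I)). (\<lambda>(f, t). f t) x \<in> U}"
    show "openin (prod_topology (mtopology_of (CI I)) (top_of_set I)) ?P"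
      unfolding openin_prod_topology_alt
    proof (intro allI impI)
      fix f t assume "(f, t) \<in> ?P"
      then have f: "f \<in> mspace (CI I)" "t \<in> I" "f t \<in> U" by auto
      then obtain e where e: "e > 0" "\<And>y. \<bar>y - f t\<bar> < e \<Longrightarrow> y \<in> U"
        using \<open>open U\<close> unfolding open_dist dist_real_def by blast
      define V where "V = {s \<in> I. \<bar>f s - f t\<bar> < e/2}"
      have cont: "continuous_on I f" using f assms by (simp add: mspace_CI)
      have "openin (top_of_set I) (I \<inter> f -` ball (f t) (e/2))"
        using cont by (intro continuous_openin_preimage_gen) auto
      also have "I \<inter> f -` ball (f t) (e/2) = V"
        unfolding V_def by (auto simp: dist_real_def abs_minus_commute)
      finally have V: "openin (top_of_set I) V" .
      have B: "openin (mtopology_of (CI I)) (C.mball f (e/2))"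
        unfolding mtopology_of_def by (rule C.openin_mball)
      have "x \<in> ?P" if "x \<in> C.mball f (e/2) \<times> V" for x
      proof -
        obtain g s where x: "x = (g, s)" by fastforce
        then have g: "g \<in> mspace (CI I)" "mdist (CI I) f g < e/2" and s: "s \<in> V"
          using that by auto
        then have "\<bar>f s - g s\<bar> < e/2" "\<bar>f s - f t\<bar> < e/2" "s \<in> I"
          using CI_dist_le[OF f(1) g(1), of s] by (auto simp: V_def)
        then have "g s \<in> U" by (intro e(2)) linarith
        then show ?thesis using g \<open>s \<in> I\<close> x by simp
      qed
      moreover have "f \<in> C.mball f (e/2)" "t \<in> V" using f e by (auto simp: V_def)
      ultimately show "\<exists>W V. openin (mtopology_of (CI I)) W \<and> openin (top_of_set I) V \<and> f \<in> W \<and> t \<in> V \<and> W \<times> V \<subseteq> ?P"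
        using B V by (intro exI conjI subsetI)
      qed
  qed
  then show ?thesis unfolding continuous_map_def by auto
qed

lemma measurable_CI_eval:
  assumes U: "U \<in> measurable M (borel_of (mtopology_of (CI {c..d})))"
    and T: "T \<in> borel_measurable M" "\<And>x. x \<in> space M \<Longrightarrow> T x \<in> {c..d}"
  shows "(\<lambda>x. U x (T x)) \<in> borel_measurable M"
  using measurable_compose_continuous_map[OF measurable_Pair_borel_of[OF U T] continuous_map_CI_eval]
  by simp

text \<open>Writing the points up to \<open>t\<close> as \<open>c + q * (t - c)\<close> makes the
  index set of the supremum independent of \<open>t\<close>; continuity then allows the restriction
  to rational \<open>q\<close>. The result is a countable supremum of evaluations, which stays
  measurable when \<open>u\<close> and \<open>t\<close> vary.\<close>

lemma cummax_eq_SUP: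
  assumes u: "continuous_on {c..d} u" and t: "t \<in> {c..d}"
  shows "cummax {c..d} u t = (SUP q\<in>\<rat> \<inter> {0..1}. u (c + q * (t - c)))"
    and "bdd_above ((\<lambda>q. u (c + q * (t - c))) ` (\<rat> \<inter> {0..1}))"
proof -
  let ?f = "\<lambda>q. c + q * (t - c)"
  have seg: "{s \<in> {c..d}. s \<le> t} = ?f ` {0..1}"
  proof (intro equalityI subsetI)
    fix s assume s: "s \<in> {s \<in> {c..d}. s \<le> t}"
    show "s \<in> ?f ` {0..1}"
    proof (cases "t = c")
      case True
      with s have "s = ?f 0" by auto
      then show ?thesis by (intro image_eqI[of _ _ 0]) auto
    next
      case False
      with s have "s = ?f ((s - c) / (t - c))" "(s - c) / (t - c) \<in> {0..1}"
        by (auto simp: field_simps)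
      then show ?thesis by blast
    qed
  next
    fix s assume "s \<in> ?f ` {0..1}"
    then obtain q where "s = ?f q" "q \<in> {0..1}" by (rule imageE)
    then have q: "s = ?f q" "0 \<le> q" "q \<le> 1" by auto
    have "q * (t - c) \<le> 1 * (t - c)" "0 \<le> q * (t - c)"
      using q t by (intro mult_right_mono mult_nonneg_nonneg; simp)+
    with q t show "s \<in> {s \<in> {c..d}. s \<le> t}" by auto
  qed
  then have f_in: "?f q \<in> {c..d}" if "q \<in> {0..1}" for q using that by blast
  have "continuous_on {0..1} (\<lambda>q. u (?f q))"
    by (rule continuous_on_compose2[OF u]) (use f_in in \<open>auto intro!: continuous_intros\<close>)
  then have bdd: "bdd_above ((\<lambda>q. u (?f q)) ` {0..1})"
    by (intro bounded_imp_bdd_above compact_imp_bounded compact_continuous_image) auto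
  have sub: "(\<lambda>q. u (?f q)) ` (\<rat> \<inter> {0..1}) \<subseteq> (\<lambda>q. u (?f q)) ` {0..1}" by auto
  show bdd': "bdd_above ((\<lambda>q. u (?f q)) ` (\<rat> \<inter> {0..1}))"
    by (rule bdd_above_mono[OF bdd sub])
  \<comment> \<open>A convex set with nonempty interior keeps its closure when intersected with a
    dense set; this also reaches the end points.\<close>
  have "closure ({0..1} \<inter> (\<rat>::real set)) = closure {0..1::real}"
    by (intro closure_convex_Int_superset) (auto simp: Rats_closure_real)
  then have cl: "closure (\<rat> \<inter> {0..1}) = {0..1::real}"
    by (simp add: Int_commute)
  have "u (?f q) \<le> (SUP q\<in>\<rat> \<inter> {0..1}. u (?f q))" if "q \<in> {0..1}" for q
    by (rule continuous_le_on_closure[of "\<rat> \<inter> {0..1}" "\<lambda>q. u (?f q)"])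
      (use that cl \<open>continuous_on {0..1} (\<lambda>q. u (?f q))\<close> bdd' in \<open>auto intro: cSUP_upper\<close>)
  then have "(SUP q\<in>{0..1}. u (?f q)) \<le> (SUP q\<in>\<rat> \<inter> {0..1}. u (?f q))"
    by (intro cSUP_least) auto
  moreover have "(SUP q\<in>\<rat> \<inter> {0..1}. u (?f q)) \<le> (SUP q\<in>{0..1}. u (?f q))"
    by (intro cSUP_subset_mono[OF _ bdd]) (auto intro: Rats_0 exI[of _ 0])
  ultimately show "cummax {c..d} u t = (SUP q\<in>\<rat> \<inter> {0..1}. u (?f q))"
    unfolding cummax_def seg image_image by simp
qed

lemma measurable_cummax:
  assumes U: "U \<in> measurable M (borel_of (mtopology_of (CI {c..d})))"
    and T: "T \<in> borel_measurable M" and T_in: "\<And>x. x \<in> space M \<Longrightarrow> T x \<in> {c..d}"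
  shows "(\<lambda>x. cummax {c..d} (U x) (T x)) \<in> borel_measurable M"
proof -
  have cont: "continuous_on {c..d} (U x)" if "x \<in> space M" for x
    using measurable_CI_space[OF U that] by (simp add: mspace_CI)
  have in_cd: "c + q * (T x - c) \<in> {c..d}" if "x \<in> space M" "q \<in> \<rat> \<inter> {0..1}" for x q
  proof -
    have "q * (T x - c) \<le> 1 * (T x - c)" "0 \<le> q * (T x - c)"
      using that T_in[of x] by (intro mult_right_mono mult_nonneg_nonneg; auto)+
    then show ?thesis using T_in[of x] that by auto
  qed
  have "(\<lambda>x. SUP q\<in>\<rat> \<inter> {0..1}. U x (c + q * (T x - c))) \<in> borel_measurable M"
  proof (rule borel_measurable_cSUP)
    show "countable (\<rat> \<inter> {0..1::real})" by (simp add: countable_rat)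
    show "(\<lambda>x. U x (c + q * (T x - c))) \<in> borel_measurable M" if "q \<in> \<rat> \<inter> {0..1}" for q
      by (intro measurable_CI_eval[OF U] in_cd that borel_measurable_add borel_measurable_times
          borel_measurable_diff T borel_measurable_const)
    show "bdd_above ((\<lambda>q. U x (c + q * (T x - c))) ` (\<rat> \<inter> {0..1}))" if "x \<in> space M" for x
      using cummax_eq_SUP(2)[OF cont[OF that] T_in[OF that]] .
  qed
  then show ?thesis
    by (subst measurable_cong[of M _ "\<lambda>x. SUP q\<in>\<rat> \<inter> {0..1}. U x (c + q * (T x - c))"])
       (auto intro!: cummax_eq_SUP(1) cont T_in)
qed

section \<open>Restriction and sign change as measurable operations on continuous functions\<close>

lemma measurable_CI_restrict:
  assumes U: "U \<in> measurable M (borel_of (mtopology_of (CI I)))" and "compact I" "compact J" "J \<subseteq> I"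
  shows "(\<lambda>x. restrict (U x) J) \<in> measurable M (borel_of (mtopology_of (CI J)))"
proof (rule measurable_compose_continuous_map[OF U])
  have "Lipschitz_continuous_map (CI I) (CI J) (\<lambda>u. restrict u J)"
    unfolding Lipschitz_continuous_map_def
  proof (intro conjI exI[of _ 1] ballI)
    show "(\<lambda>u. restrict u J) \<in> mspace (CI I) \<rightarrow> mspace (CI J)"
      using assms by (auto intro!: restrict_in_CI CI_continuous_on[of I])
    show "mdist (CI J) (restrict f J) (restrict g J) \<le> 1 * mdist (CI I) f g"
      if "f \<in> mspace (CI I)" "g \<in> mspace (CI I)" for f g
      using that \<open>J \<subseteq> I\<close> by (intro CI_dist_leI) (auto intro: CI_dist_le)
  qed
  then show "continuous_map (mtopology_of (CI I)) (mtopology_of (CI J)) (\<lambda>u. restrict u J)"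
    by (rule Lipschitz_continuous_imp_continuous_map)
qed

lemma measurable_CI_uminus:
  assumes U: "U \<in> measurable M (borel_of (mtopology_of (CI I)))" and "compact I"
  shows "(\<lambda>x. \<lambda>s\<in>I. - U x s) \<in> measurable M (borel_of (mtopology_of (CI I)))"
proof (rule measurable_compose_continuous_map[OF U])
  have "Lipschitz_continuous_map (CI I) (CI I) (\<lambda>u. \<lambda>s\<in>I. - u s)"
    unfolding Lipschitz_continuous_map_def
  proof (intro conjI exI[of _ 1] ballI)
    show "(\<lambda>u. \<lambda>s\<in>I. - u s) \<in> mspace (CI I) \<rightarrow> mspace (CI I)"
      using assms by (auto intro!: restrict_in_CI continuous_on_minus CI_continuous_on[of I])
    show "mdist (CI I) (\<lambda>s\<in>I. - f s) (\<lambda>s\<in>I. - g s) \<le> 1 * mdist (CI I) f g"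
      if "f \<in> mspace (CI I)" "g \<in> mspace (CI I)" for f g
      using CI_dist_le[OF that] by (intro CI_dist_leI) (auto simp: abs_minus_commute)
  qed
  then show "continuous_map (mtopology_of (CI I)) (mtopology_of (CI I)) (\<lambda>u. \<lambda>s\<in>I. - u s)"
    by (rule Lipschitz_continuous_imp_continuous_map)
qed

section \<open>Measurable selectors\<close>

lemma dual_CI_linear:
  assumes "\<phi> \<in> dual_CI I" "f \<in> mspace (CI I)" "g \<in> mspace (CI I)"
  shows "\<phi> (\<lambda>s\<in>I. \<alpha> * f s + \<beta> * g s) = \<alpha> * \<phi> f + \<beta> * \<phi> g"
  using assms unfolding dual_CI_def cont_linear_maps_def lin_real_def lin_CI_def by blast

lemma dual_CI_sum:
  assumes \<phi>: "\<phi> \<in> dual_CI I" and "compact I" and "finite K"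
    and f: "\<And>k. k \<in> K \<Longrightarrow> f k \<in> mspace (CI I)"
  shows "\<phi> (\<lambda>s\<in>I. \<Sum>k\<in>K. \<alpha> k * f k s) = (\<Sum>k\<in>K. \<alpha> k * \<phi> (f k))"
  using \<open>finite K\<close> f
proof (induction K)
  case empty
  have "(\<lambda>s\<in>I. 0) \<in> mspace (CI I)"
    using \<open>compact I\<close> by (intro restrict_in_CI) auto
  \<comment> \<open>Linearity with both coefficients 0 gives the value 0 at the zero
    function.\<close>
  from dual_CI_linear[OF \<phi> this this, of 0 0] show ?case
    by (simp only: mult_zero_left add_0_left sum.empty)
next
  case (insert k K)
  let ?g = "\<lambda>s\<in>I. \<Sum>k\<in>K. \<alpha> k * f k s"
  have "?g \<in> mspace (CI I)"
    using insert.prems \<open>compact I\<close>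
    by (intro restrict_in_CI continuous_intros) (auto intro: CI_continuous_on)
  then have "\<phi> (\<lambda>s\<in>I. \<alpha> k * f k s + 1 * ?g s) = \<alpha> k * \<phi> (f k) + 1 * \<phi> ?g"
    by (rule dual_CI_linear[OF \<phi> insert.prems[OF insertI1]])
  moreover have "(\<lambda>s\<in>I. \<Sum>k\<in>insert k K. \<alpha> k * f k s) = (\<lambda>s\<in>I. \<alpha> k * f k s + 1 * ?g s)"
    using insert.hyps by (intro restrict_ext) simp
  moreover have "\<phi> ?g = (\<Sum>k\<in>K. \<alpha> k * \<phi> (f k))"
    by (rule insert.IH) (rule insert.prems[OF insertI2])
  ultimately show ?case by (simp only: sum.insert[OF insert.hyps] mult_1)
qed

lemma Phi_le:
  assumes \<phi>: "\<phi> \<in> Phi I u t" and "compact I" and f: "f \<in> mspace (CI I)" and g: "g \<in> mspace (CI I)"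
    and le: "\<And>s. s \<in> I \<Longrightarrow> f s \<le> g s"
  shows "\<phi> f \<le> \<phi> g"
proof -
  have "0 \<le> \<phi> (\<lambda>s\<in>I. 1 * g s + (-1) * f s)"
  proof -
    have "(\<lambda>s\<in>I. 1 * g s + (-1) * f s) \<in> mspace (CI I)"
      using \<open>compact I\<close>
      by (intro restrict_in_CI continuous_intros CI_continuous_on[OF _ f] CI_continuous_on[OF _ g]) auto
    moreover have "\<forall>s\<in>I. 0 \<le> (\<lambda>s\<in>I. 1 * g s + (-1) * f s) s" using le by simp
    ultimately show ?thesis using \<phi> unfolding Phi_def by blast
  qed
  also have "\<dots> = 1 * \<phi> g + (-1) * \<phi> f"
    using \<phi> by (intro dual_CI_linear[OF _ g f]) (simp add: Phi_def)
  finally show ?thesis by simp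
qed

text \<open>A positive functional attains its norm at the constant 1, because \<open>h\<close> lies
  between -1 and 1 whenever its absolute value is at most 1. Norm one thus says that the represented
  measure has total mass one.\<close>

lemma Phi_const:
  assumes \<phi>: "\<phi> \<in> Phi I u t" and "compact I"
  shows "\<phi> (\<lambda>s\<in>I. y) = y"
proof -
  have in_CI: "(\<lambda>s\<in>I. y) \<in> mspace (CI I)" for y
    using \<open>compact I\<close> by (intro restrict_in_CI) auto
  have const: "\<phi> (\<lambda>s\<in>I. y) = y * \<phi> (\<lambda>s\<in>I. 1)" for y
  proof -
    have "\<phi> (\<lambda>s\<in>I. y * (\<lambda>s\<in>I. 1) s + 0 * (\<lambda>s\<in>I. 1) s) = y * \<phi> (\<lambda>s\<in>I. 1) + 0 * \<phi> (\<lambda>s\<in>I. 1)"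
      using \<phi> by (intro dual_CI_linear in_CI) (simp add: Phi_def)
    also have "(\<lambda>s\<in>I. y * (\<lambda>s\<in>I. 1) s + 0 * (\<lambda>s\<in>I. 1) s) = (\<lambda>s\<in>I. y)"
      by (intro restrict_ext) simp
    finally show ?thesis by (simp only: mult_zero_left add_0_right)
  qed
  have "dual_norm I \<phi> = \<phi> (\<lambda>s\<in>I. 1)"
    unfolding dual_norm_def
  proof (intro cSup_eq_maximum)
    have "0 \<le> \<phi> (\<lambda>s\<in>I. 1)" 
      using Phi_le[OF \<phi> \<open>compact I\<close> in_CI[of 0] in_CI[of 1]] const[of 0] by simp
    then show "\<phi> (\<lambda>s\<in>I. 1) \<in> (\<lambda>h. \<bar>\<phi> h\<bar>) ` {h \<in> mspace (CI I). \<forall>s\<in>I. \<bar>h s\<bar> \<le> 1}"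
      using in_CI by (intro image_eqI[of _ _ "\<lambda>s\<in>I. 1"]) auto
  next
    fix x assume "x \<in> (\<lambda>h. \<bar>\<phi> h\<bar>) ` {h \<in> mspace (CI I). \<forall>s\<in>I. \<bar>h s\<bar> \<le> 1}"
    then obtain h where h: "h \<in> mspace (CI I)" "\<And>s. s \<in> I \<Longrightarrow> \<bar>h s\<bar> \<le> 1" "x = \<bar>\<phi> h\<bar>" by auto
    have "\<phi> h \<le> \<phi> (\<lambda>s\<in>I. 1)" "\<phi> (\<lambda>s\<in>I. -1) \<le> \<phi> h"
      using h(2) by (auto intro!: Phi_le[OF \<phi> \<open>compact I\<close>] in_CI h(1) simp: abs_le_iff minus_le_iff)
    then show "x \<le> \<phi> (\<lambda>s\<in>I. 1)" using h(3) const[of "-1"] by simp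
  qed
  with \<phi> const[of y] show ?thesis by (simp add: Phi_def)
qed

text \<open>Monotonicity between the constants \<open>- B\<close> and \<open>B\<close>. In this form
  the norm bound carries uniform convergence through a functional that itself varies with
  \<open>x\<close>.\<close>

lemma Phi_bound:
  assumes \<phi>: "\<phi> \<in> Phi I u t" and "compact I" and h: "h \<in> mspace (CI I)"
    and B: "\<And>s. s \<in> I \<Longrightarrow> \<bar>h s\<bar> \<le> B"
  shows "\<bar>\<phi> h\<bar> \<le> B"
proof -
  have in_CI: "(\<lambda>s\<in>I. y) \<in> mspace (CI I)" for y :: real
    using \<open>compact I\<close> by (intro restrict_in_CI) auto
  have "\<phi> (\<lambda>s\<in>I. - B) \<le> \<phi> h" "\<phi> h \<le> \<phi> (\<lambda>s\<in>I. B)"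
    using B by (intro Phi_le[OF \<phi> \<open>compact I\<close>] in_CI h; force simp: abs_le_iff)+
  then show ?thesis unfolding Phi_const[OF \<phi> \<open>compact I\<close>] by simp
qed

lemma Phi_diff:
  assumes \<phi>: "\<phi> \<in> Phi I u t" and "compact I" and f: "f \<in> mspace (CI I)" and g: "g \<in> mspace (CI I)"
  shows "\<phi> (\<lambda>s\<in>I. f s - g s) = \<phi> f - \<phi> g"
  using dual_CI_linear[of \<phi> I f g 1 "-1"] assms by (simp add: Phi_def)

lemma S_Phi_in_Phi:
  assumes "\<mu> \<in> S_Phi I" "u \<in> mspace (CI I)" "t \<in> I"
  shows "\<mu> u t \<in> Phi I u t"
  using assms by (simp add: S_Phi_def)

text \<open>The weak-star topology is inherited from a product topology whose coordinates are the
  test functions, so pairing with a fixed \<open>h\<close> is a continuous coordinate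
  projection.\<close>

lemma measurable_S_Phi_const:
  assumes \<mu>: "\<mu> \<in> S_Phi I" and U: "U \<in> measurable M (borel_of (mtopology_of (CI I)))"
    and T: "T \<in> borel_measurable M" "\<And>x. x \<in> space M \<Longrightarrow> T x \<in> I"
    and h: "h \<in> mspace (CI I)"
  shows "(\<lambda>x. \<mu> (U x) (T x) h) \<in> borel_measurable M"
proof -
  have "(\<lambda>(u, t). \<mu> u t) \<in>
            measurable (borel_of (prod_topology (mtopology_of (CI I)) (top_of_set I)))
                       (borel_of (weak_star_CI I))"
    using \<mu> by (simp add: S_Phi_def)
  from measurable_compose[OF measurable_Pair_borel_of[OF U T] this]
  have "(\<lambda>x. \<mu> (U x) (T x)) \<in> measurable M (borel_of (weak_star_CI I))" by simp
  moreover have "continuous_map (weak_star_CI I) euclideanreal (\<lambda>\<phi>. \<phi> h)"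
    unfolding weak_star_CI_def
    by (intro continuous_map_from_subtopology continuous_map_product_projection h)
  ultimately have "(\<lambda>x. \<mu> (U x) (T x) h) \<in> measurable M (borel_of euclidean)"
    by (rule measurable_compose_continuous_map)
  then show ?thesis by simp
qed

text \<open>The argument \<open>H x\<close> is replaced by its Bernstein polynomials, which turn the pairing into
  finite sums of pairings with fixed functions.\<close>

lemma measurable_S_Phi:
  assumes \<mu>: "\<mu> \<in> S_Phi {c..d}" and "c \<le> d"
    and U: "U \<in> measurable M (borel_of (mtopology_of (CI {c..d})))"
    and T: "T \<in> borel_measurable M" "\<And>x. x \<in> space M \<Longrightarrow> T x \<in> {c..d}"
    and H: "H \<in> measurable M (borel_of (mtopology_of (CI {c..d})))"
  shows "(\<lambda>x. \<mu> (U x) (T x) (H x)) \<in> borel_measurable M"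
proof -
  \<comment> \<open>The Bernstein basis and its nodes, moved affinely from \<open>[0,1]\<close> to
    \<open>[c,d]\<close>. Division by zero yields 0, so for \<open>c = d\<close> or
    \<open>n = 0\<close> all nodes are \<open>c\<close> and no separate case arises.\<close>
  define b where "b n k = (\<lambda>s\<in>{c..d}. Bernstein n k ((s - c) / (d - c)))" for n k
  define node where "node n k = c + real k / real n * (d - c)" for n k
  have b: "b n k \<in> mspace (CI {c..d})" for n k
    unfolding b_def Bernstein_def
    by (cases "c = d") (auto intro!: restrict_in_CI continuous_intros)
  have node: "node n k \<in> {c..d}" if "k \<le> n" for n k
  proof -
    have "0 \<le> real k / real n" "real k / real n \<le> 1" using that by (auto simp: divide_le_eq_1)
    then have "real k / real n * (d - c) \<le> 1 * (d - c)" "0 \<le> real k / real n * (d - c)"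
      using \<open>c \<le> d\<close> by (intro mult_right_mono mult_nonneg_nonneg; simp)+
    then show ?thesis unfolding node_def by simp
  qed
  define S where "S n x = (\<Sum>k\<le>n. H x (node n k) * \<mu> (U x) (T x) (b n k))" for n x
  show ?thesis
  proof (rule borel_measurable_LIMSEQ_real)
    show "S n \<in> borel_measurable M" for n
      unfolding S_def
      by (intro borel_measurable_sum borel_measurable_times measurable_CI_eval[OF H]
          measurable_S_Phi_const[OF \<mu> U T] b borel_measurable_const) (use node in auto)
    fix x assume x: "x \<in> space M"
    define \<phi> where "\<phi> = \<mu> (U x) (T x)"
    have \<phi>: "\<phi> \<in> Phi {c..d} (U x) (T x)"
      unfolding \<phi>_def using T(2) U \<mu> x by (intro S_Phi_in_Phi) (auto intro: measurable_CI_space)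
    have Hx: "H x \<in> mspace (CI {c..d})" using H x by (rule measurable_CI_space)
    define p where "p n = (\<lambda>s\<in>{c..d}. \<Sum>k\<le>n. H x (node n k) * b n k s)" for n
    have p: "p n \<in> mspace (CI {c..d})" for n
      unfolding p_def by (intro restrict_in_CI continuous_intros CI_continuous_on[OF _ b]) auto
    \<comment> \<open>For fixed \<open>x\<close> the values of \<open>H x\<close> at the nodes are
      plain coefficients, so the sum of pairings is the pairing with one Bernstein
      polynomial.\<close>
    have S: "S n x = \<phi> (p n)" for n
      unfolding S_def p_def using \<phi> b
      by (subst dual_CI_sum) (auto simp: \<phi>_def[symmetric] Phi_def)
    show "(\<lambda>n. S n x) \<longlonglongrightarrow> \<mu> (U x) (T x) (H x)"
      unfolding LIMSEQ_iff
    proof (intro allI impI)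
      fix e :: real assume "0 < e"
      have "continuous_on {0..1} (\<lambda>q. H x (c + q * (d - c)))"
      proof (rule continuous_on_compose2[OF CI_continuous_on[OF _ Hx order_refl]])
        show "(\<lambda>q. c + q * (d - c)) ` {0..1} \<subseteq> {c..d}"
        proof (intro image_subsetI)
          fix q :: real assume "q \<in> {0..1}"
          then have "q * (d - c) \<le> 1 * (d - c)" "0 \<le> q * (d - c)"
            using \<open>c \<le> d\<close> by (intro mult_right_mono mult_nonneg_nonneg; simp)+
          then show "c + q * (d - c) \<in> {c..d}" by simp
        qed
      qed (auto intro!: continuous_intros)
      \<comment> \<open>Half of \<open>e\<close> leaves room for the weak inequality that
        \<open>Phi_bound\<close> returns.\<close>
      from Bernstein_Weierstrass[OF this, of "e/2"] \<open>0 < e\<close> obtain N where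
        N: "\<And>n q. N \<le> n \<Longrightarrow> q \<in> {0..1} \<Longrightarrow>
          \<bar>H x (c + q * (d - c)) - (\<Sum>k\<le>n. H x (c + real k / real n * (d - c)) * Bernstein n k q)\<bar> < e/2"
        by auto
      have "norm (S n x - \<mu> (U x) (T x) (H x)) < e" if "n \<ge> N" for n
      proof -
        have "\<bar>H x s - p n s\<bar> \<le> e/2" if s: "s \<in> {c..d}" for s
        proof -
          have "(s - c) / (d - c) \<in> {0..1}" using s by (auto simp: divide_le_eq_1)
          moreover have "c + (s - c) / (d - c) * (d - c) = s" using s by (cases "c = d") auto
          ultimately show ?thesis
            using N[OF \<open>n \<ge> N\<close>, of "(s - c) / (d - c)"] s by (simp add: p_def b_def node_def)
        qed
        then have "\<bar>\<phi> (\<lambda>s\<in>{c..d}. H x s - p n s)\<bar> \<le> e/2"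
          by (intro Phi_bound[OF \<phi>] restrict_in_CI continuous_intros
              CI_continuous_on[OF _ p] CI_continuous_on[OF _ Hx]) auto
        then show ?thesis
          unfolding S Phi_diff[OF \<phi> compact_Icc Hx p] using \<open>0 < e\<close> by (simp add: \<phi>_def abs_minus_commute)
      qed
      then show "\<exists>no. \<forall>n\<ge>no. norm (S n x - \<mu> (U x) (T x) (H x)) < e" by blast
    qed
  qed
qed

section \<open>A single interval\<close>

lemma cummax_eqI:
  assumes "s \<in> I" "s \<le> t" "\<And>s'. s' \<in> I \<Longrightarrow> s' \<le> t \<Longrightarrow> u s' \<le> u s"
  shows "cummax I u t = u s"
  unfolding cummax_def using assms by (intro cSup_eq_maximum) auto

lemma cummax_attained:
  assumes "continuous_on {c..d} u" "t \<in> {c..d}"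
  obtains s where "s \<in> {c..d}" "s \<le> t" "cummax {c..d} u t = u s"
    "\<And>s'. s' \<in> {c..d} \<Longrightarrow> s' \<le> t \<Longrightarrow> u s' \<le> u s"
proof -
  have "continuous_on {c..t} u" by (rule continuous_on_subset[OF assms(1)]) (use assms in auto)
  then obtain s where s: "s \<in> {c..t}" "\<forall>s'\<in>{c..t}. u s' \<le> u s"
    using continuous_attains_sup[of "{c..t}" u] assms by auto
  show thesis
  proof (rule that[of s])
    show "cummax {c..d} u t = u s" using s assms by (intro cummax_eqI) auto
  qed (use s assms in auto)
qed

text \<open>Agreement is required on the interval only. The lemma therefore moves the constants
  built from \<open>p\<close> and \<open>r\<close> out of a running maximum and at the same time
  passes between \<open>- u\<close> and its extensional restriction.\<close>

lemma cummax_shift: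
  assumes "continuous_on {c..d} u" "t \<in> {c..d}" "\<And>s. s \<in> {c..d} \<Longrightarrow> v s = u s + k"
  shows "cummax {c..d} v t = cummax {c..d} u t + k"
proof -
  obtain s where s: "s \<in> {c..d}" "s \<le> t" "cummax {c..d} u t = u s"
    "\<And>s'. s' \<in> {c..d} \<Longrightarrow> s' \<le> t \<Longrightarrow> u s' \<le> u s"
    using cummax_attained[OF assms(1,2)] by metis
  then have "cummax {c..d} v t = v s" using assms(3) by (intro cummax_eqI) auto
  then show ?thesis using assms(3) s by simp
qed

text \<open>Compactness bounds the set of differences, without which the real supremum in
  \<open>osc\<close> would say nothing about them.\<close>

lemma osc_le_iff:
  assumes "compact I" "I \<noteq> {}" "continuous_on I u"
  shows "osc I u \<le> B \<longleftrightarrow> (\<forall>s\<in>I. \<forall>t\<in>I. \<bar>u t - u s\<bar> \<le> B)"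
proof -
  have "compact ((\<lambda>p. \<bar>u (snd p) - u (fst p)\<bar>) ` (I \<times> I))"
    using assms
    by (intro compact_continuous_image compact_Times continuous_intros
        continuous_on_compose2[OF assms(3)]) auto
  then have "bdd_above ((\<lambda>p. \<bar>u (snd p) - u (fst p)\<bar>) ` (I \<times> I))"
    by (intro bounded_imp_bdd_above compact_imp_bounded)
  then show ?thesis unfolding osc_def using assms(2) by (subst cSUP_le_iff) auto
qed

lemma osc_less:
  assumes "compact I" "continuous_on I u" "osc I u < r" "s \<in> I" "t \<in> I"
  shows "\<bar>u t - u s\<bar> < r"
proof -
  have "\<bar>u t - u s\<bar> \<le> osc I u" using osc_le_iff[of I u "osc I u"] assms by auto
  with assms(3) show ?thesis by simp
qed

context
  fixes r c d :: real and u :: "real \<Rightarrow> real" and p :: real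
  assumes cd: "c \<le> d" and r: "0 < r" and Z: "(u, p) \<in> Z_I r {c..d}"
begin

lemma Z_I_cont: "continuous_on {c..d} u" and Z_I_CI: "u \<in> mspace (CI {c..d})"
  using Z by (auto simp: Z_I_def intro: CI_continuous_on)

lemma Z_I_uminus_cont: "continuous_on {c..d} (\<lambda>s\<in>{c..d}. - u s)"
    and Z_I_uminus_CI: "(\<lambda>s\<in>{c..d}. - u s) \<in> mspace (CI {c..d})"
proof -
  show "(\<lambda>s\<in>{c..d}. - u s) \<in> mspace (CI {c..d})"
    using Z_I_cont by (intro restrict_in_CI continuous_intros) auto
  then show "continuous_on {c..d} (\<lambda>s\<in>{c..d}. - u s)" by (intro CI_continuous_on) auto
qed

text \<open>The running maximum of \<open>- u\<close> is minus the running minimum of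
  \<open>u\<close>; this form speaks of minimisers of \<open>u\<close> and hides the restricted
  function.\<close>

lemma Z_I_min_attained:
  assumes "t \<in> {c..d}"
  obtains s where "s \<in> {c..d}" "s \<le> t" "cummax {c..d} (\<lambda>s\<in>{c..d}. - u s) t = - u s"
    "\<And>s'. s' \<in> {c..d} \<Longrightarrow> s' \<le> t \<Longrightarrow> u s \<le> u s'"
proof (rule cummax_attained[OF Z_I_uminus_cont assms])
  fix s assume s: "s \<in> {c..d}" "s \<le> t"
    "cummax {c..d} (\<lambda>s\<in>{c..d}. - u s) t = (\<lambda>s\<in>{c..d}. - u s) s"
    "\<And>s'. s' \<in> {c..d} \<Longrightarrow> s' \<le> t \<Longrightarrow> (\<lambda>s\<in>{c..d}. - u s) s' \<le> (\<lambda>s\<in>{c..d}. - u s) s"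
  show thesis
  proof (rule that[OF s(1,2)])
    show "cummax {c..d} (\<lambda>s\<in>{c..d}. - u s) t = - u s"
      using s(3) restrict_apply'[OF s(1), of "\<lambda>s. - u s"] by (rule trans)
    show "u s \<le> u s'" if "s' \<in> {c..d}" "s' \<le> t" for s'
      using s(4)[OF that] s(1) that by simp
  qed
qed

lemma Z_I_osc: "s \<in> {c..d} \<Longrightarrow> t \<in> {c..d} \<Longrightarrow> u t - u s < r"
  using osc_less[OF compact_Icc Z_I_cont, of r s t] Z by (auto simp: Z_I_def)

lemma w_plus_eq:
  "t \<in> {c..d} \<Longrightarrow> w_plus r {c..d} u p t = max p (cummax {c..d} u t - r)"
  using cummax_shift[OF Z_I_cont, of t "\<lambda>s. u s - r" "- r"] by (simp add: w_plus_def)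

lemma w_minus_eq:
  "t \<in> {c..d} \<Longrightarrow> w_minus r {c..d} u p t = min p (r - cummax {c..d} (\<lambda>s\<in>{c..d}. - u s) t)"
  using cummax_shift[OF Z_I_uminus_cont, of t "\<lambda>s. - u s - r" "- r"] by (simp add: w_minus_def)

text \<open>As \<open>osc u < r\<close>, the constraint on \<open>u - w\<close> can only fail where \<open>w = p\<close>; so \<open>Z_plus\<close> is the
  set \<open>p < r + min u\<close>, and \<open>Z_minus\<close> is \<open>p > max u - r\<close>.\<close>

lemma Z_plus_iff: "(u, p) \<in> Z_plus r {c..d} \<longleftrightarrow> p < r - cummax {c..d} (\<lambda>s\<in>{c..d}. - u s) d"
proof -
  have d: "d \<in> {c..d}" using cd by simp
  obtain s0 where s0: "s0 \<in> {c..d}" "s0 \<le> d" "cummax {c..d} (\<lambda>s\<in>{c..d}. - u s) d = - u s0"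
    "\<And>s. s \<in> {c..d} \<Longrightarrow> s \<le> d \<Longrightarrow> u s0 \<le> u s"
    by (rule Z_I_min_attained[OF d]) blast
  \<comment> \<open>On the branch \<open>w = u s - r\<close> one has
    \<open>u t - w = r - (u s - u t) > 0 > - r\<close>, so only the branch \<open>w = p\<close>
    leaves a condition.\<close>
  have "u t - w_plus r {c..d} u p t > - r \<longleftrightarrow> p < u t + r" if t: "t \<in> {c..d}" for t
  proof -
    obtain s where "s \<in> {c..d}" "cummax {c..d} u t = u s"
      by (rule cummax_attained[OF Z_I_cont t])
    then show ?thesis using Z_I_osc[OF t, of s] r w_plus_eq[OF t] by auto
  qed
  then have "(u, p) \<in> Z_plus r {c..d} \<longleftrightarrow> (\<forall>t\<in>{c..d}. p < u t + r)"
    using Z unfolding Z_plus_def by auto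
  also have "\<dots> \<longleftrightarrow> p < r + u s0"
    using s0(1,4) by force
  finally show ?thesis using s0(3) by simp
qed

lemma Z_minus_iff: "(u, p) \<in> Z_minus r {c..d} \<longleftrightarrow> cummax {c..d} u d - r < p"
proof -
  have d: "d \<in> {c..d}" using cd by simp
  obtain s0 where s0: "s0 \<in> {c..d}" "s0 \<le> d" "cummax {c..d} u d = u s0"
    "\<And>s. s \<in> {c..d} \<Longrightarrow> s \<le> d \<Longrightarrow> u s \<le> u s0"
    by (rule cummax_attained[OF Z_I_cont d]) blast
  have "u t - w_minus r {c..d} u p t < r \<longleftrightarrow> u t - r < p" if t: "t \<in> {c..d}" for t
  proof -
    obtain s where "s \<in> {c..d}" "cummax {c..d} (\<lambda>s\<in>{c..d}. - u s) t = - u s"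
      by (rule Z_I_min_attained[OF t])
    then show ?thesis using Z_I_osc[OF _ t, of s] r w_minus_eq[OF t] by auto
  qed
  then have "(u, p) \<in> Z_minus r {c..d} \<longleftrightarrow> (\<forall>t\<in>{c..d}. u t - r < p)"
    using Z unfolding Z_minus_def by auto
  also have "\<dots> \<longleftrightarrow> u s0 - r < p"
    using s0(1,4) by force
  finally show ?thesis using s0(3) by simp
qed

text \<open>Failure of the first condition means \<open>p\<close> is at least
  \<open>r + min u\<close>. This exceeds \<open>max u\<close>, since the oscillation is below
  \<open>r\<close>, and hence \<open>max u - r\<close>.\<close>

lemma Z_plus_or_minus:
  assumes "(u, p) \<notin> Z_plus r {c..d}"
  shows "(u, p) \<in> Z_minus r {c..d}"
proof -
  have d: "d \<in> {c..d}" using cd by simp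
  obtain s where s: "s \<in> {c..d}" "cummax {c..d} (\<lambda>s\<in>{c..d}. - u s) d = - u s"
    by (rule Z_I_min_attained[OF d])
  obtain s' where s': "s' \<in> {c..d}" "cummax {c..d} u d = u s'"
    by (rule cummax_attained[OF Z_I_cont d])
  show ?thesis
    using assms s s' Z_I_osc[OF s(1) s'(1)] r by (simp add: Z_plus_iff Z_minus_iff)
qed

text \<open>Membership in \<open>Z_plus\<close> is replaced by the threshold of
  \<open>Z_plus_iff\<close>, so \<open>P_I\<close> becomes a case distinction between measurable
  expressions.\<close>

lemma P_I_eq:
  assumes "t \<in> {c..d}"
  shows "P_I r {c..d} u p t =
    (if p < r - cummax {c..d} (\<lambda>s\<in>{c..d}. - u s) d then max p (cummax {c..d} u t - r)
     else min p (r - cummax {c..d} (\<lambda>s\<in>{c..d}. - u s) t))"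
  using assms by (simp add: P_I_def Z_plus_iff w_plus_eq w_minus_eq)

end

text \<open>Both clauses of \<open>S_I\<close> in one expression, with constants pulled out of the
  running maxima and out of the pairings. Both branches are convex combinations of
  \<open>\<eta>\<close> and the pairing with \<open>h\<close>.\<close>

definition S_I_form ::
  "real \<Rightarrow> real \<Rightarrow> real \<Rightarrow> (real \<Rightarrow> real) \<Rightarrow> (real \<Rightarrow> real) \<Rightarrow>
    ((real \<Rightarrow> real) \<Rightarrow> real \<Rightarrow> (real \<Rightarrow> real) \<Rightarrow> real) \<Rightarrow> ((real \<Rightarrow> real) \<Rightarrow> real \<Rightarrow> (real \<Rightarrow> real) \<Rightarrow> real) \<Rightarrow>
    (real \<Rightarrow> real) \<Rightarrow> real \<Rightarrow> real \<Rightarrow> (real \<Rightarrow> real) \<Rightarrow> real \<Rightarrow> real" where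
  "S_I_form r c d lp lm mp mm u p t h \<eta> =
     (if p < r - cummax {c..d} (\<lambda>s\<in>{c..d}. - u s) d
      then \<eta> + lp (cummax {c..d} u t - p - r) * (mp u t h - \<eta>)
      else \<eta> + lm (cummax {c..d} (\<lambda>s\<in>{c..d}. - u s) t + p - r) * (mm (\<lambda>s\<in>{c..d}. - u s) t h - \<eta>))"

text \<open>The minus clause is read off only outside \<open>Z_plus\<close>, where
  \<open>Z_plus_or_minus\<close> makes it available. The number \<open>\<eta>\<close> leaves the
  pairing because the selectors have total mass one.\<close>

lemma S_I_formE:
  assumes "\<nu> \<in> S_I r {c..d}" and cd: "c \<le> d" and r: "0 < r"
  obtains lp lm mp mm where "lp \<in> S_H" "lm \<in> S_H" "mp \<in> S_Phi {c..d}" "mm \<in> S_Phi {c..d}"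
    "\<And>u p t h \<eta>. (u, p) \<in> Z_I r {c..d} \<Longrightarrow> t \<in> {c..d} \<Longrightarrow> h \<in> mspace (CI {c..d}) \<Longrightarrow>
      \<nu> u p t (h, \<eta>) = S_I_form r c d lp lm mp mm u p t h \<eta>"
proof -
  let ?I = "{c..d}"
  obtain lp lm mp mm where S: "lp \<in> S_H" "lm \<in> S_H" "mp \<in> S_Phi ?I" "mm \<in> S_Phi ?I"
    and *: "\<forall>(u, p)\<in>Z_plus r ?I. \<forall>t\<in>?I. \<forall>h\<in>mspace (CI ?I). \<forall>\<eta>.
      \<nu> u p t (h, \<eta>) = \<eta> + lp (cummax ?I (\<lambda>s. u s - p - r) t) * mp u t (\<lambda>s\<in>?I. h s - \<eta>)"
      "\<forall>(u, p)\<in>Z_minus r ?I. \<forall>t\<in>?I. \<forall>h\<in>mspace (CI ?I). \<forall>\<eta>.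
      \<nu> u p t (h, \<eta>) = \<eta> + lm (cummax ?I (\<lambda>s. - u s + p - r) t) * mm (\<lambda>s\<in>?I. - u s) t (\<lambda>s\<in>?I. h s - \<eta>)"
    using assms(1) unfolding S_I_def mem_Collect_eq by (elim conjE bexE) (rule that)
  have plus: "\<nu> u p t (h, \<eta>) = \<eta> + lp (cummax ?I (\<lambda>s. u s - p - r) t) * mp u t (\<lambda>s\<in>?I. h s - \<eta>)"
    if "(u, p) \<in> Z_plus r ?I" "t \<in> ?I" "h \<in> mspace (CI ?I)" for u p t h \<eta>
    using bspec[OF *(1) that(1)] that(2,3) by simp
  have minus: "\<nu> u p t (h, \<eta>) = \<eta> + lm (cummax ?I (\<lambda>s. - u s + p - r) t) * mm (\<lambda>s\<in>?I. - u s) t (\<lambda>s\<in>?I. h s - \<eta>)"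
    if "(u, p) \<in> Z_minus r ?I" "t \<in> ?I" "h \<in> mspace (CI ?I)" for u p t h \<eta>
    using bspec[OF *(2) that(1)] that(2,3) by simp
  have "\<nu> u p t (h, \<eta>) = S_I_form r c d lp lm mp mm u p t h \<eta>"
    if Z: "(u, p) \<in> Z_I r ?I" and t: "t \<in> ?I" and h: "h \<in> mspace (CI ?I)" for u p t h \<eta>
  proof -
    have diff: "\<phi> (\<lambda>s\<in>?I. h s - \<eta>) = \<phi> h - \<eta>" if "\<phi> \<in> Phi ?I v t" for \<phi> v
    proof -
      have "(\<lambda>s\<in>?I. \<eta>) \<in> mspace (CI ?I)" by (intro restrict_in_CI) auto
      from Phi_diff[OF that compact_Icc h this] Phi_const[OF that compact_Icc]
      have "\<phi> (\<lambda>s\<in>?I. h s - (\<lambda>s\<in>?I. \<eta>) s) = \<phi> h - \<eta>" by (simp only:)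
      also have "(\<lambda>s\<in>?I. h s - (\<lambda>s\<in>?I. \<eta>) s) = (\<lambda>s\<in>?I. h s - \<eta>)" by (intro restrict_ext) simp
      finally show ?thesis .
    qed
    show ?thesis
    proof (cases "(u, p) \<in> Z_plus r ?I")
      case True
      have "cummax ?I (\<lambda>s. u s - p - r) t = cummax ?I u t - p - r"
        using cummax_shift[OF Z_I_cont[OF cd r Z] t, of "\<lambda>s. u s - p - r" "- p - r"] by simp
      moreover have "mp u t (\<lambda>s\<in>?I. h s - \<eta>) = mp u t h - \<eta>"
        by (rule diff[OF S_Phi_in_Phi[OF S(3) Z_I_CI[OF cd r Z] t]])
      ultimately show ?thesis
        using True Z_plus_iff[OF cd r Z] plus[OF True t h, of \<eta>] by (simp add: S_I_form_def)
    next
      case False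
      have "cummax ?I (\<lambda>s. - u s + p - r) t = cummax ?I (\<lambda>s\<in>?I. - u s) t + p - r"
        using cummax_shift[OF Z_I_uminus_cont[OF cd r Z] t, of "\<lambda>s. - u s + p - r" "p - r"] by simp
      moreover have "mm (\<lambda>s\<in>?I. - u s) t (\<lambda>s\<in>?I. h s - \<eta>) = mm (\<lambda>s\<in>?I. - u s) t h - \<eta>"
        by (rule diff[OF S_Phi_in_Phi[OF S(4) Z_I_uminus_CI[OF cd r Z] t]])
      ultimately show ?thesis
        using False Z_plus_iff[OF cd r Z] minus[OF Z_plus_or_minus[OF cd r Z False] t h, of \<eta>]
        by (simp add: S_I_form_def)
    qed
  qed
  with S show thesis by (rule that)
qed

lemma convex_comb_bound:
  fixes \<eta> m l B :: real
  assumes "0 \<le> l" "l \<le> 1" "\<bar>\<eta>\<bar> \<le> B" "\<bar>m\<bar> \<le> B"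
  shows "\<bar>\<eta> + l * (m - \<eta>)\<bar> \<le> B"
proof -
  have "\<eta> + l * (m - \<eta>) = (1 - l) * \<eta> + l * m" by (simp add: algebra_simps)
  also have "\<bar>\<dots>\<bar> \<le> (1 - l) * \<bar>\<eta>\<bar> + l * \<bar>m\<bar>"
    using assms by (intro order_trans[OF abs_triangle_ineq]) (simp add: abs_mult)
  also have "\<dots> \<le> (1 - l) * B + l * B"
    using assms by (intro add_mono mult_left_mono) auto
  finally show ?thesis by (simp add: algebra_simps)
qed

text \<open>A convex combination is bounded by the larger of the two bounds, not by their sum. Hence
  the same \<open>B\<close> survives the passage to the next interval.\<close>

lemma S_I_bound:
  assumes \<nu>: "\<nu> \<in> S_I r {c..d}" and cd: "c \<le> d" and r: "0 < r"
    and Z: "(u, p) \<in> Z_I r {c..d}" and t: "t \<in> {c..d}" and h: "h \<in> mspace (CI {c..d})"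
    and B: "\<bar>\<eta>\<bar> \<le> B" "\<And>s. s \<in> {c..d} \<Longrightarrow> \<bar>h s\<bar> \<le> B"
  shows "\<bar>\<nu> u p t (h, \<eta>)\<bar> \<le> B"
proof -
  obtain lp lm mp mm where S: "lp \<in> S_H" "lm \<in> S_H" "mp \<in> S_Phi {c..d}" "mm \<in> S_Phi {c..d}"
    and eq: "\<nu> u p t (h, \<eta>) = S_I_form r c d lp lm mp mm u p t h \<eta>"
    using S_I_formE[OF \<nu> cd r] Z t h by metis
  have "\<bar>mp u t h\<bar> \<le> B"
    by (rule Phi_bound[OF S_Phi_in_Phi[OF S(3) Z_I_CI[OF cd r Z] t] compact_Icc h B(2)])
  moreover have "\<bar>mm (\<lambda>s\<in>{c..d}. - u s) t h\<bar> \<le> B"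
    by (rule Phi_bound[OF S_Phi_in_Phi[OF S(4) Z_I_uminus_CI[OF cd r Z] t] compact_Icc h B(2)])
  ultimately show ?thesis
    using S(1,2) B(1) unfolding eq S_I_form_def S_H_def by (auto intro!: convex_comb_bound)
qed

section \<open>Measurability on a single interval\<close>

lemma S_H_measurable:
  assumes "l \<in> S_H"
  shows "l \<in> borel_measurable borel"
proof -
  have "l = (\<lambda>x. if x < 0 then 0 else if x = 0 then l 0 else 1)"
    using assms by (auto simp: S_H_def)
  moreover have "(\<lambda>x::real. if x < 0 then 0 else if x = 0 then l 0 else 1) \<in> borel_measurable borel"
    by measurable
  ultimately show ?thesis by metis
qed

lemma S_R_measurable:
  assumes "l \<in> S_R r"
  shows "l \<in> borel_measurable borel"
proof -
  have "l x = (if \<bar>x\<bar> > r then 0 else if \<bar>x\<bar> < r then 1 else if x = r then l r else l (- r))" for x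
    using assms by (auto simp: S_R_def abs_if split: if_splits)
  then have "l = (\<lambda>x. if \<bar>x\<bar> > r then 0 else if \<bar>x\<bar> < r then 1 else if x = r then l r else l (- r))" by blast
  moreover have "(\<lambda>x::real. if \<bar>x\<bar> > r then 0 else if \<bar>x\<bar> < r then 1 else if x = r then l r else l (- r)) \<in> borel_measurable borel"
    by measurable
  ultimately show ?thesis by metis
qed

context
  fixes M :: "'w measure" and r c d :: real and U :: "'w \<Rightarrow> real \<Rightarrow> real" and P T :: "'w \<Rightarrow> real"
  assumes cd: "c \<le> d" and r: "0 < r"
    and U: "U \<in> measurable M (borel_of (mtopology_of (CI {c..d})))"
    and P[measurable]: "P \<in> borel_measurable M"
    and T[measurable]: "T \<in> borel_measurable M" and T_in: "\<And>x. x \<in> space M \<Longrightarrow> T x \<in> {c..d}"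
    and Z: "\<And>x. x \<in> space M \<Longrightarrow> (U x, P x) \<in> Z_I r {c..d}"
begin

lemmas U_uminus = measurable_CI_uminus[OF U compact_Icc]

lemma measurable_cummaxes [measurable]:
  "(\<lambda>x. cummax {c..d} (U x) (T x)) \<in> borel_measurable M"
  "(\<lambda>x. cummax {c..d} (\<lambda>s\<in>{c..d}. - U x s) (T x)) \<in> borel_measurable M"
  "(\<lambda>x. cummax {c..d} (\<lambda>s\<in>{c..d}. - U x s) d) \<in> borel_measurable M"
  using cd by (auto intro!: measurable_cummax[OF U T T_in] measurable_cummax[OF U_uminus T T_in]
      measurable_cummax[OF U_uminus borel_measurable_const])

lemma measurable_P_I: "(\<lambda>x. P_I r {c..d} (U x) (P x) (T x)) \<in> borel_measurable M"
  by (subst measurable_cong[OF P_I_eq[OF cd r Z T_in]]) measurable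

lemma measurable_S_I:
  assumes \<nu>: "\<nu> \<in> S_I r {c..d}"
    and H: "H \<in> measurable M (borel_of (mtopology_of (CI {c..d})))"
    and [measurable]: "E \<in> borel_measurable M"
  shows "(\<lambda>x. \<nu> (U x) (P x) (T x) (H x, E x)) \<in> borel_measurable M"
proof -
  obtain lp lm mp mm where S: "lp \<in> S_H" "lm \<in> S_H" "mp \<in> S_Phi {c..d}" "mm \<in> S_Phi {c..d}"
    and eq: "\<And>u p t h \<eta>. (u, p) \<in> Z_I r {c..d} \<Longrightarrow> t \<in> {c..d} \<Longrightarrow> h \<in> mspace (CI {c..d}) \<Longrightarrow>
      \<nu> u p t (h, \<eta>) = S_I_form r c d lp lm mp mm u p t h \<eta>"
    using S_I_formE[OF \<nu> cd r] by metis
  note [measurable] = S(1,2)[THEN S_H_measurable]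
  have [measurable]: "(\<lambda>x. mp (U x) (T x) (H x)) \<in> borel_measurable M"
    by (rule measurable_S_Phi[OF S(3) cd U T T_in H])
  have [measurable]: "(\<lambda>x. mm (\<lambda>s\<in>{c..d}. - U x s) (T x) (H x)) \<in> borel_measurable M"
    by (rule measurable_S_Phi[OF S(4) cd U_uminus T T_in H])
  have "(\<lambda>x. S_I_form r c d lp lm mp mm (U x) (P x) (T x) (H x) (E x)) \<in> borel_measurable M"
    unfolding S_I_form_def by measurable
  \<comment> \<open>The form determines \<open>\<nu>\<close> only on \<open>Z_I\<close> and for
    times in the interval, so the exchange is made on \<open>space M\<close>, where \<open>Z\<close>
    and \<open>T_in\<close> apply.\<close>
  then show ?thesis
    by (subst measurable_cong[OF eq[OF Z T_in measurable_CI_space[OF H]]])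
qed

end

section \<open>Partitions\<close>

lemma osc_restrict: "osc I (restrict u I) = osc I u"
  unfolding osc_def by (intro arg_cong[where f = Sup] image_cong) auto

text \<open>The pieces on which \<open>S_D\<close> prescribes the maps, merged into one family; only
  the first is closed on the left.\<close>

definition ppiece :: "real list \<Rightarrow> nat \<Rightarrow> real set" where
  "ppiece D k = (if k = 1 then {D ! 0..D ! 1} else {D ! (k - 1)<..D ! k})"

context
  fixes a b r :: real and D :: "real list"
  assumes part: "is_partition a b D" and r: "0 < r"
begin

lemma partition_mono: "i \<le> j \<Longrightarrow> j < length D \<Longrightarrow> D ! i \<le> D ! j"
  using part sorted_wrt_nth_less[of "(<)" D i j] unfolding is_partition_def
  by (cases "i = j") auto

lemma partition_ends: "D ! 0 = a" "D ! (length D - 1) = b" "0 < length D"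
proof -
  have "D \<noteq> []" using part by (auto simp: is_partition_def)
  then show "D ! 0 = a" "D ! (length D - 1) = b" "0 < length D"
    using part hd_conv_nth[of D] last_conv_nth[of D] by (auto simp: is_partition_def)
qed

lemma partition_in: "i < length D \<Longrightarrow> D ! i \<in> {a..b}"
  using partition_mono[of 0 i] partition_mono[of i "length D - 1"] partition_ends by auto

lemma pint_subset: "k < length D \<Longrightarrow> pint D k \<subseteq> {a..b}"
  using partition_in[of k] partition_in[of "k - 1"] by (auto simp: pint_def)

text \<open>Truncated subtraction gives \<open>0 - 1 = 0\<close>, so the interval of index 0 shrinks
  to the first node. This is where \<open>S_k\<close> prescribes its elements for
  \<open>k = 0\<close>, and inductions can start there.\<close>

lemma pint_0: "pint D 0 = {D ! 0}"
  by (simp add: pint_def)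

lemma pint_Suc: "Suc k < length D \<Longrightarrow> D ! k \<le> D ! Suc k" "pint D (Suc k) = {D ! k..D ! Suc k}"
  using partition_mono[of k "Suc k"] by (auto simp: pint_def)

text \<open>The condition in \<open>Z_I\<close> concerns \<open>u\<close> alone. Any
  \<open>p\<close> may be taken, in particular the value of \<open>w_D\<close> at the previous
  node.\<close>

lemma Z_D_restrict:
  assumes "(u, z) \<in> Z_D a b r D" "Suc k < length D"
  shows "(restrict u {D ! k..D ! Suc k}, p) \<in> Z_I r {D ! k..D ! Suc k}"
proof -
  have u: "u \<in> mspace (CI {a..b})" and osc: "osc (pint D (Suc k)) u < r"
    using assms by (auto simp: Z_D_def)
  have "restrict u {D ! k..D ! Suc k} \<in> mspace (CI {D ! k..D ! Suc k})"
    using pint_subset[OF assms(2)] unfolding pint_Suc(2)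
    by (intro restrict_in_CI CI_continuous_on[OF _ u]) auto
  with osc show ?thesis unfolding Z_I_def pint_Suc(2) by (simp add: osc_restrict)
qed

lemma S_k_SucE:
  assumes "\<mu> \<in> S_k a b r D (Suc k)"
  obtains \<nu> \<mu>' where "\<nu> \<in> S_I r {D ! k..D ! Suc k}" "\<mu>' \<in> S_k a b r D k"
    "\<And>u z t h y. (u, z) \<in> Z_D a b r D \<Longrightarrow> t \<in> {D ! k..D ! Suc k} \<Longrightarrow> h \<in> mspace (CI {a..b}) \<Longrightarrow>
       \<mu> u z t (h, y) = \<nu> (restrict u {D ! k..D ! Suc k}) (w_D r D k u z) t
         (restrict h {D ! k..D ! Suc k}, \<mu>' u z (D ! k) (h, y))"
proof -
  obtain \<nu> \<mu>' where S: "\<nu> \<in> S_I r (pint D (Suc k))" "\<mu>' \<in> S_k a b r D k"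
    and *: "\<forall>(u, z0)\<in>Z_D a b r D. \<forall>t\<in>pint D (Suc k).
            \<mu> u z0 t \<in> dual_CIR {a..b} \<and>
            (\<forall>h\<in>mspace (CI {a..b}). \<forall>y.
               \<mu> u z0 t (h, y) =
                 \<nu> (restrict u (pint D (Suc k))) (w_D r D k u z0) t
                   (restrict h (pint D (Suc k)), \<mu>' u z0 (D ! k) (h, y)))"
    using assms unfolding S_k.simps mem_Collect_eq by (elim conjE bexE) (rule that)
  show thesis
  proof (rule that[OF S[unfolded pint_Suc]])
    fix u z t h and y :: real
    assume "(u, z) \<in> Z_D a b r D" "t \<in> {D ! k..D ! Suc k}" "h \<in> mspace (CI {a..b})"
    then show "\<mu> u z t (h, y) = \<nu> (restrict u {D ! k..D ! Suc k}) (w_D r D k u z) t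
         (restrict h {D ! k..D ! Suc k}, \<mu>' u z (D ! k) (h, y))"
      using bspec[OF *, of "(u, z)"] unfolding pint_Suc(2) by simp
  qed
qed

lemma S_k_dual:
  assumes "\<mu> \<in> S_k a b r D k" "(u, z) \<in> Z_D a b r D" "t \<in> pint D k"
  shows "\<mu> u z t \<in> dual_CIR {a..b}"
  using assms by (cases k) (fastforce simp: pint_0)+

text \<open>At the first node the bound holds because \<open>l0\<close> has values in
  \<open>[0,1]\<close>. Later intervals combine convexly the value at the previous node and a mean
  of \<open>h\<close>, so the bound does not grow with \<open>k\<close>.\<close>

lemma S_k_bound:
  assumes "k < length D" "\<mu> \<in> S_k a b r D k" and Z: "(u, z) \<in> Z_D a b r D" and "t \<in> pint D k"
    and h: "h \<in> mspace (CI {a..b})" and B: "\<And>s. s \<in> {a..b} \<Longrightarrow> \<bar>h s\<bar> \<le> B"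
  shows "\<bar>\<mu> u z t (h, y)\<bar> \<le> B + \<bar>y\<bar>"
  using assms(1,2,4)
proof (induction k arbitrary: \<mu> t)
  case 0
  then obtain l0 where l0: "l0 \<in> S_R r" "\<mu> u z t (h, y) = h a - l0 z * y"
    using Z h by (fastforce simp: pint_0)
  have "\<bar>l0 z * y\<bar> \<le> 1 * \<bar>y\<bar>"
    using l0(1) unfolding abs_mult by (intro mult_right_mono) (auto simp: S_R_def)
  moreover have "\<bar>h a\<bar> \<le> B" using B[of a] partition_in[of 0] partition_ends by auto
  ultimately show ?case unfolding l0(2) by linarith
next
  case (Suc k)
  let ?I = "{D ! k..D ! Suc k}"
  obtain \<nu> \<mu>' where S: "\<nu> \<in> S_I r ?I" "\<mu>' \<in> S_k a b r D k"
    and eq: "\<And>u z t h y. (u, z) \<in> Z_D a b r D \<Longrightarrow> t \<in> ?I \<Longrightarrow> h \<in> mspace (CI {a..b}) \<Longrightarrow>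
       \<mu> u z t (h, y) = \<nu> (restrict u ?I) (w_D r D k u z) t (restrict h ?I, \<mu>' u z (D ! k) (h, y))"
    using S_k_SucE[OF Suc.prems(2)] by metis
  have sub: "?I \<subseteq> {a..b}" using pint_subset[OF Suc.prems(1)] unfolding pint_Suc(2) .
  have "B \<ge> 0" using B[of a] partition_in[of 0] partition_ends by force
  have t: "t \<in> ?I" using Suc.prems(3) unfolding pint_Suc(2) .
  have "D ! k \<in> pint D k"
    using partition_mono[of "k - 1" k] Suc.prems(1) by (auto simp: pint_def)
  then have "\<bar>\<mu>' u z (D ! k) (h, y)\<bar> \<le> B + \<bar>y\<bar>"
    using Suc.prems(1) by (intro Suc.IH S) auto
  moreover have "\<bar>restrict h ?I s\<bar> \<le> B + \<bar>y\<bar>" if "s \<in> ?I" for s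
    using B[of s] sub that by auto
  moreover have "restrict h ?I \<in> mspace (CI ?I)"
    using sub by (intro restrict_in_CI CI_continuous_on[OF _ h]) auto
  ultimately show ?case
    unfolding eq[OF Z t h]
    using S_I_bound[OF S(1) pint_Suc(1)[OF Suc.prems(1)] r Z_D_restrict[OF Z Suc.prems(1)] t] by blast
qed

lemma S_D_pieceE:
  assumes "\<mu> \<in> S_D a b r D"
  obtains m where "\<And>k. k \<in> {1..<length D} \<Longrightarrow> m k \<in> S_k a b r D k"
    "\<And>u z k t. (u, z) \<in> Z_D a b r D \<Longrightarrow> k \<in> {1..<length D} \<Longrightarrow> t \<in> ppiece D k \<Longrightarrow> \<mu> u z t = m k u z t"
proof -
  obtain m where m: "\<forall>k\<in>{1..<length D}. m k \<in> S_k a b r D k"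
    and *: "\<forall>(u, z0)\<in>Z_D a b r D.
             (\<forall>t\<in>{D ! 0..D ! 1}. \<mu> u z0 t = m 1 u z0 t) \<and>
             (\<forall>k\<in>{2..<length D}. \<forall>t\<in>{D ! (k - 1)<..D ! k}. \<mu> u z0 t = m k u z0 t)"
    using assms unfolding S_D_def mem_Collect_eq by (elim conjE exE) (rule that)
  show thesis
  proof (rule that)
    show "m k \<in> S_k a b r D k" if "k \<in> {1..<length D}" for k using m that by blast
    fix u z k t assume Z: "(u, z) \<in> Z_D a b r D" and k: "k \<in> {1..<length D}" and t: "t \<in> ppiece D k"
    from bspec[OF * Z] k t show "\<mu> u z t = m k u z t"
      by (cases "k = 1") (auto simp: ppiece_def)
  qed
qed

lemma ppiece_subset: "ppiece D k \<subseteq> pint D k"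
  by (auto simp: ppiece_def pint_def)

lemma ppiece_cover:
  assumes "t \<in> {a..b}"
  shows "\<exists>k\<in>{1..<length D}. t \<in> ppiece D k"
proof -
  \<comment> \<open>Minimality places \<open>t\<close> strictly to the right of the previous node.
    Index 0 is excluded so that \<open>t = a\<close> falls into the first piece.\<close>
  define k where "k = (LEAST k. 1 \<le> k \<and> t \<le> D ! k)"
  have "2 \<le> length D" using part by (simp add: is_partition_def)
  then have *: "1 \<le> length D - 1 \<and> t \<le> D ! (length D - 1)"
    using assms partition_ends by auto
  then have k: "1 \<le> k \<and> t \<le> D ! k" unfolding k_def by (rule LeastI)
  have "k \<le> length D - 1" unfolding k_def using * by (rule Least_le)
  then have "k \<in> {1..<length D}" using k \<open>2 \<le> length D\<close> by auto
  moreover have "t \<in> ppiece D k"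
  proof (cases "k = 1")
    case True
    then show ?thesis using k assms partition_ends by (simp add: ppiece_def)
  next
    case False
    then have "\<not> (1 \<le> k - 1 \<and> t \<le> D ! (k - 1))"
      using k unfolding k_def by (intro not_less_Least) auto
    then show ?thesis using k False by (auto simp: ppiece_def)
  qed
  ultimately show ?thesis by blast
qed

lemma S_D_dual:
  assumes "\<mu> \<in> S_D a b r D" "(u, z) \<in> Z_D a b r D" "t \<in> {a..b}"
  shows "\<mu> u z t \<in> dual_CIR {a..b}"
proof -
  obtain m where m: "\<And>k. k \<in> {1..<length D} \<Longrightarrow> m k \<in> S_k a b r D k"
    "\<And>u z k t. (u, z) \<in> Z_D a b r D \<Longrightarrow> k \<in> {1..<length D} \<Longrightarrow> t \<in> ppiece D k \<Longrightarrow> \<mu> u z t = m k u z t"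
    using S_D_pieceE[OF assms(1)] by metis
  obtain k where k: "k \<in> {1..<length D}" "t \<in> ppiece D k" using ppiece_cover[OF assms(3)] by blast
  show ?thesis
    unfolding m(2)[OF assms(2) k] using ppiece_subset k by (intro S_k_dual[OF m(1)[OF k(1)] assms(2)]) auto
qed

lemma S_D_bound:
  assumes "\<mu> \<in> S_D a b r D" "(u, z) \<in> Z_D a b r D" "t \<in> {a..b}"
    and h: "h \<in> mspace (CI {a..b})" and B: "\<And>s. s \<in> {a..b} \<Longrightarrow> \<bar>h s\<bar> \<le> B"
  shows "\<bar>\<mu> u z t (h, y)\<bar> \<le> B + \<bar>y\<bar>"
proof -
  obtain m where m: "\<And>k. k \<in> {1..<length D} \<Longrightarrow> m k \<in> S_k a b r D k"
    "\<And>u z k t. (u, z) \<in> Z_D a b r D \<Longrightarrow> k \<in> {1..<length D} \<Longrightarrow> t \<in> ppiece D k \<Longrightarrow> \<mu> u z t = m k u z t"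
    using S_D_pieceE[OF assms(1)] by metis
  obtain k where k: "k \<in> {1..<length D}" "t \<in> ppiece D k" using ppiece_cover[OF assms(3)] by blast
  show ?thesis
    unfolding m(2)[OF assms(2) k] using ppiece_subset k
    by (intro S_k_bound[OF _ m(1)[OF k(1)] assms(2) _ h B]) auto
qed

section \<open>Measurability along a partition\<close>

context
  fixes M :: "'w measure" and U :: "'w \<Rightarrow> real \<Rightarrow> real" and z :: "'w \<Rightarrow> real"
  assumes U: "U \<in> measurable M (borel_of (mtopology_of (CI {a..b})))"
    and z: "z \<in> borel_measurable M"
    and Z: "\<And>x. x \<in> space M \<Longrightarrow> (U x, z x) \<in> Z_D a b r D"
begin

lemma measurable_restrict_pint:
  assumes "Suc k < length D" "W \<in> measurable M (borel_of (mtopology_of (CI {a..b})))"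
  shows "(\<lambda>x. restrict (W x) {D ! k..D ! Suc k}) \<in> measurable M (borel_of (mtopology_of (CI {D ! k..D ! Suc k})))"
  using pint_subset[OF assms(1)] by (intro measurable_CI_restrict[OF assms(2)]) (auto simp: pint_Suc)

lemma measurable_w_D: "k < length D \<Longrightarrow> (\<lambda>x. w_D r D k (U x) (z x)) \<in> borel_measurable M"
proof (induction k)
  case 0
  have "(\<lambda>x. U x (D ! 0)) \<in> borel_measurable M"
    using partition_in[OF 0] by (intro measurable_CI_eval[OF U]) auto
  then show ?case using z by (simp add: proj_def)
next
  case (Suc k)
  show ?case
    unfolding w_D.simps pint_Suc(2)
    using Suc pint_Suc(1)[of k]
    by (intro measurable_P_I[OF _ r measurable_restrict_pint[OF _ U]] Z_D_restrict[OF Z]) auto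
qed

lemma measurable_S_k:
  assumes "k < length D" "\<mu> \<in> S_k a b r D k"
    and "T \<in> borel_measurable M" "\<And>x. x \<in> space M \<Longrightarrow> T x \<in> pint D k"
    and H: "H \<in> measurable M (borel_of (mtopology_of (CI {a..b})))" and E: "E \<in> borel_measurable M"
  shows "(\<lambda>x. \<mu> (U x) (z x) (T x) (H x, E x)) \<in> borel_measurable M"
  using assms(1-4)
proof (induction k arbitrary: \<mu> T)
  case 0
  then obtain l0 where l0: "l0 \<in> S_R r" and
    *: "\<forall>(u, z0)\<in>Z_D a b r D. \<mu> u z0 (D ! 0) \<in> dual_CIR {a..b} \<and>
          (\<forall>h\<in>mspace (CI {a..b}). \<forall>y. \<mu> u z0 (D ! 0) (h, y) = h a - l0 z0 * y)"
    unfolding S_k.simps mem_Collect_eq by (elim conjE bexE)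
  have eq: "\<mu> (U x) (z x) (T x) (H x, E x) = H x a - l0 (z x) * E x" if "x \<in> space M" for x
    using bspec[OF * Z[OF that]] measurable_CI_space[OF H that] 0(4)[OF that] by (simp add: pint_0)
  have "(\<lambda>x. H x a) \<in> borel_measurable M"
    using partition_in[of 0] partition_ends by (intro measurable_CI_eval[OF H]) auto
  then have "(\<lambda>x. H x a - l0 (z x) * E x) \<in> borel_measurable M"
    using measurable_compose[OF z S_R_measurable[OF l0]] E by measurable
  then show ?case by (subst measurable_cong[OF eq])
next
  case (Suc k)
  let ?I = "{D ! k..D ! Suc k}"
  obtain \<nu> \<mu>' where S: "\<nu> \<in> S_I r ?I" "\<mu>' \<in> S_k a b r D k"
    and eq: "\<And>u z t h y. (u, z) \<in> Z_D a b r D \<Longrightarrow> t \<in> ?I \<Longrightarrow> h \<in> mspace (CI {a..b}) \<Longrightarrow>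
       \<mu> u z t (h, y) = \<nu> (restrict u ?I) (w_D r D k u z) t (restrict h ?I, \<mu>' u z (D ! k) (h, y))"
    using S_k_SucE[OF Suc.prems(2)] by metis
  note k = Suc.prems(1)
  have T: "T x \<in> ?I" if "x \<in> space M" for x using Suc.prems(4)[OF that] unfolding pint_Suc(2) .
  have pint: "D ! k \<in> pint D k"
    using partition_mono[of "k - 1" k] Suc.prems(1) by (auto simp: pint_def)
  \<comment> \<open>The second argument of \<open>\<nu>\<close> is the previous functional at the
    fixed node \<open>D ! k\<close>; keeping \<open>T\<close> arbitrary in the induction permits
    this constant time.\<close>
  have E': "(\<lambda>x. \<mu>' (U x) (z x) (D ! k) (H x, E x)) \<in> borel_measurable M"
    by (rule Suc.IH[OF Suc_lessD[OF k] S(2) borel_measurable_const pint])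
  have "(\<lambda>x. \<nu> (restrict (U x) ?I) (w_D r D k (U x) (z x)) (T x)
      (restrict (H x) ?I, \<mu>' (U x) (z x) (D ! k) (H x, E x))) \<in> borel_measurable M"
    by (rule measurable_S_I[OF pint_Suc(1)[OF k] r measurable_restrict_pint[OF k U]
          measurable_w_D[OF Suc_lessD[OF k]] Suc.prems(3) T Z_D_restrict[OF Z k] S(1)
          measurable_restrict_pint[OF k H] E'])
  then show ?case
    by (subst measurable_cong[OF eq[OF Z T measurable_CI_space[OF H]]])
qed

end

text \<open>Which formula applies depends on the piece containing \<open>T x\<close>. The space is
  cut into the finitely many preimages of the pieces, and \<open>measurable_S_k\<close> is used on
  each of these restricted spaces.\<close>

lemma measurable_S_D:
  fixes M :: "'w measure"
  assumes \<mu>: "\<mu> \<in> S_D a b r D"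
    and U: "U \<in> measurable M (borel_of (mtopology_of (CI {a..b})))"
    and z: "z \<in> borel_measurable M"
    and Z: "\<And>x. x \<in> space M \<Longrightarrow> (U x, z x) \<in> Z_D a b r D"
    and T: "T \<in> borel_measurable M" "\<And>x. x \<in> space M \<Longrightarrow> T x \<in> {a..b}"
    and H: "H \<in> measurable M (borel_of (mtopology_of (CI {a..b})))" and E: "E \<in> borel_measurable M"
  shows "(\<lambda>x. \<mu> (U x) (z x) (T x) (H x, E x)) \<in> borel_measurable M"
proof -
  obtain m where m: "\<And>k. k \<in> {1..<length D} \<Longrightarrow> m k \<in> S_k a b r D k"
    "\<And>u z k t. (u, z) \<in> Z_D a b r D \<Longrightarrow> k \<in> {1..<length D} \<Longrightarrow> t \<in> ppiece D k \<Longrightarrow> \<mu> u z t = m k u z t"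
    using S_D_pieceE[OF \<mu>] by metis
  let ?A = "\<lambda>k. T -` ppiece D k \<inter> space M"
  show ?thesis
  proof (rule measurable_piecewise_restrict[of "?A ` {1..<length D}"])
    show "space M \<subseteq> \<Union> (?A ` {1..<length D})" using ppiece_cover T(2) by fastforce
    show "A \<inter> space M \<in> sets M" if "A \<in> ?A ` {1..<length D}" for A
    proof -
      have "ppiece D k \<in> sets borel" for k by (simp add: ppiece_def)
      then show ?thesis using that measurable_sets[OF T(1)] by (auto simp: Int_assoc)
    qed
    fix A assume "A \<in> ?A ` {1..<length D}"
    then obtain k where k: "k \<in> {1..<length D}" "A = ?A k" by blast
    let ?M = "restrict_space M A"
    have sp: "x \<in> space M" "T x \<in> ppiece D k" if "x \<in> space ?M" for x
      using that k by (auto simp: space_restrict_space)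
    have "(\<lambda>x. m k (U x) (z x) (T x) (H x, E x)) \<in> borel_measurable ?M"
    proof (rule measurable_S_k[where U = U and z = z and T = T and \<mu> = "m k" and H = H and E = E])
      show "k < length D" using k by simp
      show "m k \<in> S_k a b r D k" by (rule m(1)[OF k(1)])
      show "(U x, z x) \<in> Z_D a b r D" if "x \<in> space ?M" for x by (rule Z[OF sp(1)[OF that]])
      show "T x \<in> pint D k" if "x \<in> space ?M" for x using sp(2)[OF that] ppiece_subset by blast
    qed (rule measurable_restrict_space1[OF U] measurable_restrict_space1[OF z]
        measurable_restrict_space1[OF T(1)] measurable_restrict_space1[OF H] measurable_restrict_space1[OF E])+
    then show "(\<lambda>x. \<mu> (U x) (z x) (T x) (H x, E x)) \<in> borel_measurable ?M"
      by (subst measurable_cong[of _ _ "\<lambda>x. m k (U x) (z x) (T x) (H x, E x)"])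
        (simp_all only: m(2)[OF Z[OF sp(1)] k(1) sp(2)])
  qed auto
qed

end

section \<open>Operators into the space of essentially bounded functions\<close>

lemma Linf_class_cong: "AE t in M. f t = g t \<Longrightarrow> Linf_class M f = Linf_class M g"
  unfolding Linf_class_def by (intro Collect_cong conj_cong refl) (auto elim: eventually_elim2)

lemma Linf_class_self: "f \<in> borel_measurable M \<Longrightarrow> f \<in> Linf_class M f"
  by (simp add: Linf_class_def)

lemma Linf_class_in_space:
  assumes "f \<in> borel_measurable M" "AE t in M. \<bar>f t\<bar> \<le> C"
  shows "Linf_class M f \<in> Linf_space M"
proof -
  have "esssup M (\<lambda>t. ereal \<bar>f t\<bar>) \<le> ereal C"
    using assms by (intro esssup_I) auto
  then have "esssup M (\<lambda>t. ereal \<bar>f t\<bar>) < \<infinity>" by (rule le_less_trans) simp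
  then show ?thesis using assms(1) unfolding Linf_space_def by blast
qed

lemma Linf_dist_class_le:
  assumes f: "f \<in> borel_measurable M" "AE t in M. \<bar>f t\<bar> \<le> B"
    and g: "g \<in> borel_measurable M" "AE t in M. \<bar>g t\<bar> \<le> C"
    and "0 \<le> c" "AE t in M. \<bar>f t - g t\<bar> \<le> c"
  shows "Linf_dist M (Linf_class M f) (Linf_class M g) \<le> c"
  unfolding Linf_dist_eq[OF Linf_class_in_space[OF f] Linf_class_in_space[OF g]
      Linf_class_self[OF f(1)] Linf_class_self[OF g(1)]]
  using assms by (subst real_esssup_le_iff[where C = c]) auto

text \<open>All representatives yield the same class, so the union in \<open>lin_Linf\<close>
  collapses.\<close>

lemma lin_Linf_class:
  assumes f: "f \<in> borel_measurable M" and g: "g \<in> borel_measurable M"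
  shows "lin_Linf M \<alpha> (Linf_class M f) \<beta> (Linf_class M g) = Linf_class M (\<lambda>t. \<alpha> * f t + \<beta> * g t)"
proof -
  have "Linf_class M (\<lambda>t. \<alpha> * f' t + \<beta> * g' t) = Linf_class M (\<lambda>t. \<alpha> * f t + \<beta> * g t)"
    if "f' \<in> Linf_class M f" "g' \<in> Linf_class M g" for f' g'
    using that unfolding Linf_class_def mem_Collect_eq
    by (intro Linf_class_cong[unfolded Linf_class_def]) (auto elim: eventually_elim2)
  then show ?thesis
    using Linf_class_self[OF f] Linf_class_self[OF g] unfolding lin_Linf_def by blast
qed

lemma dual_CIR_linear:
  assumes "\<phi> \<in> dual_CIR I" "p \<in> mspace (CIR I)" "q \<in> mspace (CIR I)"
  shows "\<phi> (lin_CIR I \<alpha> p \<beta> q) = \<alpha> * \<phi> p + \<beta> * \<phi> q"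
  using assms unfolding dual_CIR_def cont_linear_maps_def lin_real_def by blast

lemma CIR_dist_components:
  "mdist (CI I) (fst p) (fst q) \<le> mdist (CIR I) p q"
  "\<bar>snd p - snd q\<bar> \<le> mdist (CIR I) p q"
  by (cases p; cases q; auto simp: prod_dist_def dist_real_def intro!: real_le_rsqrt)+

lemma lin_CI_in_CI:
  assumes "compact I" and f: "f \<in> mspace (CI I)" and g: "g \<in> mspace (CI I)"
  shows "lin_CI I \<alpha> f \<beta> g \<in> mspace (CI I)"
  unfolding lin_CI_def
  using CI_continuous_on[OF assms(1) f] CI_continuous_on[OF assms(1) g]
  by (intro restrict_in_CI assms(1) continuous_intros) auto

text \<open>Continuity of each single functional would not give continuity into the space of bounded
  functions. The bound uniform in \<open>t\<close>, applied to a difference of arguments, makes the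
  operator Lipschitz.\<close>

lemma op_of_in_ops:
  assumes dual: "\<And>t. t \<in> {a..b} \<Longrightarrow> \<phi> t \<in> dual_CIR {a..b}"
    and meas: "\<And>q. q \<in> mspace (CIR {a..b}) \<Longrightarrow> (\<lambda>t. \<phi> t q) \<in> borel_measurable (leb_ab a b)"
    and bound: "\<And>t h y B. t \<in> {a..b} \<Longrightarrow> h \<in> mspace (CI {a..b}) \<Longrightarrow>
      (\<And>s. s \<in> {a..b} \<Longrightarrow> \<bar>h s\<bar> \<le> B) \<Longrightarrow> \<bar>\<phi> t (h, y)\<bar> \<le> B + \<bar>y\<bar>"
  shows "op_of a b \<phi> \<in> ops_CR_Linf a b"
proof -
  let ?X = "CIR {a..b}" and ?M = "leb_ab a b"
  have AE_ab: "AE t in ?M. P t" if "\<And>t. t \<in> {a..b} \<Longrightarrow> P t" for P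
    using that by (intro AE_I2) (auto simp: space_restrict_space)
  have bd: "\<exists>C. AE t in ?M. \<bar>\<phi> t q\<bar> \<le> C" if q: "q \<in> mspace ?X" for q
  proof -
    have h: "fst q \<in> mspace (CI {a..b})" using q by auto
    have "compact (fst q ` {a..b})"
      by (intro compact_continuous_image CI_continuous_on[OF _ h]) auto
    then obtain B where "\<And>s. s \<in> {a..b} \<Longrightarrow> \<bar>fst q s\<bar> \<le> B"
      using compact_imp_bounded bounded_real by (metis image_eqI)
    then have "\<bar>\<phi> t q\<bar> \<le> B + \<bar>snd q\<bar>" if "t \<in> {a..b}" for t
      using bound[OF that h, of B "snd q"] by simp
    then show ?thesis by (intro exI AE_ab)
  qed
  have in_space: "Linf_class ?M (\<lambda>t. \<phi> t q) \<in> Linf_space ?M" if "q \<in> mspace ?X" for q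
    using bd[OF that] Linf_class_in_space[OF meas[OF that]] by (elim exE)
  \<comment> \<open>The constant 2 comes from adding the two component distances, each at most the
    Euclidean product distance.\<close>
  have lip: "Linf_dist ?M (Linf_class ?M (\<lambda>t. \<phi> t p)) (Linf_class ?M (\<lambda>t. \<phi> t q)) \<le> 2 * mdist ?X p q"
    if p: "p \<in> mspace ?X" and q: "q \<in> mspace ?X" for p q
  proof -
    have h: "fst p \<in> mspace (CI {a..b})" "fst q \<in> mspace (CI {a..b})" using p q by auto
    have "\<bar>\<phi> t p - \<phi> t q\<bar> \<le> 2 * mdist ?X p q" if t: "t \<in> {a..b}" for t
    proof -
      have "\<bar>lin_CI {a..b} 1 (fst p) (-1) (fst q) s\<bar> \<le> mdist (CI {a..b}) (fst p) (fst q)"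
        if "s \<in> {a..b}" for s
        using CI_dist_le[OF h that] that by (simp add: lin_CI_def)
      then have "\<bar>\<phi> t (lin_CI {a..b} 1 (fst p) (-1) (fst q), snd p - snd q)\<bar>
          \<le> mdist (CI {a..b}) (fst p) (fst q) + \<bar>snd p - snd q\<bar>"
        by (rule bound[OF t lin_CI_in_CI[OF compact_Icc h]])
      also have "\<phi> t (lin_CI {a..b} 1 (fst p) (-1) (fst q), snd p - snd q) = \<phi> t p - \<phi> t q"
        using dual_CIR_linear[OF dual[OF t] p q, of 1 "-1"] by (simp add: lin_CIR_def)
      finally show ?thesis using CIR_dist_components[where I = "{a..b}" and p = p and q = q] by linarith
    qed
    then have AE: "AE t in ?M. \<bar>\<phi> t p - \<phi> t q\<bar> \<le> 2 * mdist ?X p q" by (rule AE_ab)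
    obtain B C where BC: "AE t in ?M. \<bar>\<phi> t p\<bar> \<le> B" "AE t in ?M. \<bar>\<phi> t q\<bar> \<le> C"
      using bd[OF p] bd[OF q] by (elim exE)
    have "0 \<le> 2 * mdist ?X p q" using CIR_dist_components(2)[of p q "{a..b}"] by linarith
    then show ?thesis by (rule Linf_dist_class_le[OF meas[OF p] BC(1) meas[OF q] BC(2) _ AE])
  qed
  have "Lipschitz_continuous_map ?X (Linf_metric ?M) (op_of a b \<phi>)"
    unfolding Lipschitz_continuous_map_def
    by (intro conjI exI[of _ 2] ballI)
      (use in_space lip in \<open>auto simp: op_of_def simp del: mspace_prod_metric mdist_prod_metric\<close>)
  then have "continuous_map (mtopology_of ?X) (mtopology_of (Linf_metric ?M)) (op_of a b \<phi>)"
    by (rule Lipschitz_continuous_imp_continuous_map)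
  moreover have "op_of a b \<phi> (lin_CIR {a..b} \<alpha> p \<beta> q) = lin_Linf ?M \<alpha> (op_of a b \<phi> p) \<beta> (op_of a b \<phi> q)"
    if p: "p \<in> mspace ?X" and q: "q \<in> mspace ?X" for p q \<alpha> \<beta>
  proof -
    have h: "fst p \<in> mspace (CI {a..b})" "fst q \<in> mspace (CI {a..b})" using p q by auto
    have "lin_CIR {a..b} \<alpha> p \<beta> q \<in> mspace ?X"
      unfolding lin_CIR_def mspace_prod_metric using lin_CI_in_CI[OF compact_Icc h] by simp
    moreover have "Linf_class ?M (\<lambda>t. \<phi> t (lin_CIR {a..b} \<alpha> p \<beta> q)) = Linf_class ?M (\<lambda>t. \<alpha> * \<phi> t p + \<beta> * \<phi> t q)"
      by (intro Linf_class_cong AE_ab dual_CIR_linear dual p q)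
    ultimately show ?thesis
      using p q lin_Linf_class[OF meas[OF p] meas[OF q]] unfolding op_of_def by (simp only: restrict_apply')
  qed
  ultimately show ?thesis
    unfolding ops_CR_Linf_def cont_linear_maps_def op_of_def by blast
qed

lemma op_of_cong:
  assumes "\<And>t. t \<in> {a..b} \<Longrightarrow> \<phi> t = \<psi> t"
  shows "op_of a b \<phi> = op_of a b \<psi>"
  unfolding op_of_def
  by (intro restrict_ext Linf_class_cong AE_I2) (auto simp: space_restrict_space assms)

section \<open>Gluing\<close>

lemma mtopology_of_CIR:
  "mtopology_of (CIR I) = prod_topology (mtopology_of (CI I)) euclidean"
  using Metric_space12.mtopology_prod_metric[OF Metric_space12_mspace_mdist, of "CI I" "euclidean_metric :: real metric"]
  by (simp add: mtopology_of_def)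

lemma sets_Vbar:
  assumes U: "U \<in> measurable M (borel_of (mtopology_of (CI {a..b})))" and z: "z \<in> borel_measurable M"
  shows "{x \<in> space M. (U x, z x) \<in> Vbar a b Ds rs n} \<in> sets M"
proof (cases "n = 0")
  case False
  have "(\<lambda>x. (U x, z x)) \<in> measurable M (borel_of (mtopology_of (CIR {a..b})))"
    using measurable_Pair_borel_of[OF U z, of UNIV] by (simp add: mtopology_of_CIR)
  moreover have "Vbar a b Ds rs n \<in> sets (borel_of (mtopology_of (CIR {a..b})))"
    using False by (simp add: Vbar_def closedin_borel_of)
  ultimately have "(\<lambda>x. (U x, z x)) -` Vbar a b Ds rs n \<inter> space M \<in> sets M" by (rule measurable_sets)
  then show ?thesis by (simp add: vimage_def Int_def conj_commute)
qed (simp add: Vbar_def)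

context
  fixes a b r :: real and Ds :: "nat \<Rightarrow> real list" and rs :: "nat \<Rightarrow> real"
  assumes r: "0 < r" and Ds: "admissible_partitions a b Ds" and rs: "admissible_radii r rs"
begin

lemma admissible_is_partition: "1 \<le> n \<Longrightarrow> is_partition a b (Ds n)"
  using Ds by (simp add: admissible_partitions_def)

lemma admissible_radius: "1 \<le> n \<Longrightarrow> rs n < r"
  using rs by (simp add: admissible_radii_def)

lemma admissible_radius_mono: "1 \<le> n \<Longrightarrow> rs 1 \<le> rs n"
proof (induction n rule: dec_induct)
  case (step n)
  then have "rs n < rs (Suc n)" using rs by (simp add: admissible_radii_def)
  with step.IH show ?case by simp
qed simp

lemma osc_pint_le_iff:
  assumes "1 \<le> n" "k \<in> {1..<length (Ds n)}" "u \<in> mspace (CI {a..b})"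
  shows "osc (pint (Ds n) k) u \<le> B \<longleftrightarrow> (\<forall>s\<in>pint (Ds n) k. \<forall>t\<in>pint (Ds n) k. \<bar>u t - u s\<bar> \<le> B)"
proof (rule osc_le_iff)
  note part = admissible_is_partition[OF assms(1)]
  show "pint (Ds n) k \<noteq> {}" "compact (pint (Ds n) k)"
    using partition_mono[OF part r, of "k - 1" k] assms(2) by (auto simp: pint_def)
  show "continuous_on (pint (Ds n) k) u"
    using pint_subset[OF part r, of k] assms(2) by (intro CI_continuous_on[OF _ assms(3)]) auto
qed

text \<open>A point of the closure is uniformly close to some \<open>v\<close> in \<open>V\<close>,
  and oscillation changes by at most twice the uniform distance.\<close>

lemma Vbar_subset:
  assumes n: "1 \<le> n" and uz: "(u, z) \<in> Vbar a b Ds rs n"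
  shows "(u, z) \<in> Z_D a b r (Ds n)"
proof -
  let ?X = "CIR {a..b}"
  interpret X: Metric_space "mspace ?X" "mdist ?X" by (rule Metric_space_mspace_mdist)
  \<comment> \<open>Passing from \<open>v\<close> to \<open>u\<close> costs \<open>2 * e\<close>,
    half of the gap between \<open>rs n\<close> and \<open>r\<close>; the estimate stays strictly
    below \<open>r\<close> after taking the supremum.\<close>
  define e where "e = (r - rs n) / 4"
  have "0 < e" using admissible_radius[OF n] by (simp add: e_def)
  have "(u, z) \<in> X.mtopology closure_of V a b Ds rs n"
    using uz n by (simp add: Vbar_def mtopology_of_def)
  then have "(u, z) \<in> mspace ?X" and "\<exists>q\<in>V a b Ds rs n. q \<in> X.mball (u, z) e"
    using \<open>0 < e\<close> unfolding X.metric_closure_of by blast+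
  then obtain v w where vw: "(v, w) \<in> V a b Ds rs n" "mdist ?X (u, z) (v, w) < e"
    unfolding X.in_mball by (metis surj_pair)
  have u: "u \<in> mspace (CI {a..b})" using \<open>(u, z) \<in> mspace ?X\<close> by simp
  have v: "v \<in> mspace (CI {a..b})" using vw(1) by (simp add: V_def Z_D_def)
  have uv: "\<bar>u s - v s\<bar> < e" if "s \<in> {a..b}" for s
    using CI_dist_le[OF u v that] CIR_dist_components(1)[of "{a..b}" "(u, z)" "(v, w)"] vw(2) by simp
  have "osc (pint (Ds n) k) u < r" if k: "k \<in> {1..<length (Ds n)}" for k
  proof -
    have sub: "pint (Ds n) k \<subseteq> {a..b}"
      using pint_subset[OF admissible_is_partition[OF n] r] k by simp
    have "osc (pint (Ds n) k) v \<le> rs n" using vw(1) k by (auto simp: V_def Z_D_def intro: less_imp_le)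
    then have v_le: "\<bar>v t - v s\<bar> \<le> rs n" if "s \<in> pint (Ds n) k" "t \<in> pint (Ds n) k" for s t
      using osc_pint_le_iff[OF n k v] that by blast
    have "\<bar>u t - u s\<bar> \<le> rs n + 2 * e" if "s \<in> pint (Ds n) k" "t \<in> pint (Ds n) k" for s t
    proof -
      have "s \<in> {a..b}" "t \<in> {a..b}" using sub that by auto
      then show ?thesis using v_le[OF that] uv[of s] uv[of t] by linarith
    qed
    then have "osc (pint (Ds n) k) u \<le> rs n + 2 * e" using osc_pint_le_iff[OF n k u] by blast
    also have "\<dots> < r" using admissible_radius[OF n] by (simp add: e_def field_simps)
    finally show ?thesis .
  qed
  then show ?thesis using u by (simp add: Z_D_def)
qed

text \<open>Uniform continuity and vanishing mesh put the pair into some \<open>V n\<close>; the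
  least index whose closure contains it names the layer.\<close>

lemma layer_exists:
  assumes u: "u \<in> mspace (CI {a..b})"
  shows "\<exists>n\<ge>1. (u, z) \<in> Vbar a b Ds rs n - Vbar a b Ds rs (n - 1)"
proof -
  have "0 < rs 1" using rs by (simp add: admissible_radii_def)
  have "uniformly_continuous_on {a..b} u"
    by (intro compact_uniformly_continuous CI_continuous_on[OF _ u]) auto
  \<comment> \<open>All radii are at least \<open>rs 1\<close>, so one modulus of continuity works
    before \<open>n\<close> is known. The half keeps the supremum strictly below
    \<open>rs n\<close>.\<close>
  then obtain \<delta> where \<delta>: "0 < \<delta>"
    "\<And>s t. s \<in> {a..b} \<Longrightarrow> t \<in> {a..b} \<Longrightarrow> \<bar>t - s\<bar> < \<delta> \<Longrightarrow> \<bar>u t - u s\<bar> < rs 1 / 2"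
    using \<open>0 < rs 1\<close> unfolding uniformly_continuous_on_def dist_real_def by (metis half_gt_zero)
  have "\<forall>\<^sub>F n in sequentially. mesh (Ds n) < \<delta>"
    using Ds \<delta>(1) unfolding admissible_partitions_def by (intro order_tendstoD(2)[of _ 0]) auto
  then obtain N where "\<And>n. n \<ge> N \<Longrightarrow> mesh (Ds n) < \<delta>" unfolding eventually_sequentially by blast
  then obtain n where n: "1 \<le> n" "mesh (Ds n) < \<delta>" by (metis nat_le_linear)
  have "osc (pint (Ds n) k) u < rs n" if k: "k \<in> {1..<length (Ds n)}" for k
  proof -
    have "Ds n ! k - Ds n ! (k - 1) \<le> mesh (Ds n)"
      unfolding mesh_def using k by (intro Max_ge) auto
    then have "\<bar>t - s\<bar> < \<delta>" if "s \<in> pint (Ds n) k" "t \<in> pint (Ds n) k" for s t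
      using that n(2) by (auto simp: pint_def)
    moreover have "pint (Ds n) k \<subseteq> {a..b}"
      using pint_subset[OF admissible_is_partition[OF n(1)] r] k by simp
    ultimately have "\<bar>u t - u s\<bar> \<le> rs 1 / 2" if "s \<in> pint (Ds n) k" "t \<in> pint (Ds n) k" for s t
      using that by (intro less_imp_le \<delta>(2)) auto
    then have "osc (pint (Ds n) k) u \<le> rs 1 / 2" using osc_pint_le_iff[OF n(1) k u] by blast
    then show ?thesis using admissible_radius_mono[OF n(1)] \<open>0 < rs 1\<close> by linarith
  qed
  then have "(u, z) \<in> V a b Ds rs n" using u by (simp add: V_def Z_D_def)
  moreover have "V a b Ds rs n \<subseteq> topspace (mtopology_of (CIR {a..b}))"
    by (auto simp: V_def Z_D_def)
  ultimately have "(u, z) \<in> mtopology_of (CIR {a..b}) closure_of V a b Ds rs n"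
    using closure_of_subset by blast
  then have ex: "(u, z) \<in> Vbar a b Ds rs n" using n(1) by (simp add: Vbar_def)
  define m where "m = (LEAST n. (u, z) \<in> Vbar a b Ds rs n)"
  have m: "(u, z) \<in> Vbar a b Ds rs m" unfolding m_def using ex by (rule LeastI)
  \<comment> \<open>The convention that \<open>Vbar\<close> is empty at 0 keeps the least index
    positive.\<close>
  then have "1 \<le> m" by (cases m) (auto simp: Vbar_def)
  moreover from this have "(u, z) \<notin> Vbar a b Ds rs (m - 1)"
    unfolding m_def by (intro not_less_Least) (simp add: m_def[symmetric])
  ultimately show ?thesis using m by blast
qed

text \<open>The preimages of the layers are differences of preimages of closed sets and form a
  countable cover; on each, \<open>muP\<close> agrees with one \<open>muD n\<close>.\<close>

lemma measurable_layers:
  fixes M :: "'w measure"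
  assumes muD: "\<And>n. n \<ge> 1 \<Longrightarrow> muD n \<in> S_D a b r (Ds n)"
    and muP: "\<And>n v p t. n \<ge> 1 \<Longrightarrow> (v, p) \<in> Vbar a b Ds rs n - Vbar a b Ds rs (n - 1) \<Longrightarrow>
                t \<in> {a..b} \<Longrightarrow> muP v p t = muD n v p t"
    and U: "U \<in> measurable M (borel_of (mtopology_of (CI {a..b})))" and z: "z \<in> borel_measurable M"
    and T: "T \<in> borel_measurable M" "\<And>x. x \<in> space M \<Longrightarrow> T x \<in> {a..b}"
    and H: "H \<in> measurable M (borel_of (mtopology_of (CI {a..b})))" and E: "E \<in> borel_measurable M"
  shows "(\<lambda>x. muP (U x) (z x) (T x) (H x, E x)) \<in> borel_measurable M"
proof -
  let ?L = "\<lambda>n. {x \<in> space M. (U x, z x) \<in> Vbar a b Ds rs n}"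
  let ?A = "\<lambda>n. ?L n - ?L (n - 1)"
  show ?thesis
  proof (rule measurable_piecewise_restrict[of "?A ` {1..}"])
    show "space M \<subseteq> \<Union> (?A ` {1..})"
    proof
      fix x assume x: "x \<in> space M"
      from layer_exists[OF measurable_CI_space[OF U x], of "z x"] x
      show "x \<in> \<Union> (?A ` {1..})" by auto
    qed
    show "A \<inter> space M \<in> sets M" if "A \<in> ?A ` {1..}" for A
      using that sets_Vbar[OF U z] by (auto intro!: sets.Int sets.Diff)
    fix A assume "A \<in> ?A ` {1..}"
    then obtain n where n: "1 \<le> n" "A = ?A n" by auto
    let ?M = "restrict_space M A"
    have sp: "x \<in> space M" "(U x, z x) \<in> Vbar a b Ds rs n - Vbar a b Ds rs (n - 1)" if "x \<in> space ?M" for x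
      using that n by (auto simp: space_restrict_space)
    have "(\<lambda>x. muD n (U x) (z x) (T x) (H x, E x)) \<in> borel_measurable ?M"
    proof (rule measurable_S_D[OF admissible_is_partition[OF n(1)] r muD[OF n(1)],
          where U = U and z = z and T = T and H = H and E = E])
      show "(U x, z x) \<in> Z_D a b r (Ds n)" if "x \<in> space ?M" for x
        using Vbar_subset[OF n(1)] sp(2)[OF that] by blast
      show "T x \<in> {a..b}" if "x \<in> space ?M" for x by (rule T(2)[OF sp(1)[OF that]])
    qed (rule measurable_restrict_space1[OF U] measurable_restrict_space1[OF z]
        measurable_restrict_space1[OF T(1)] measurable_restrict_space1[OF H] measurable_restrict_space1[OF E])+
    then show "(\<lambda>x. muP (U x) (z x) (T x) (H x, E x)) \<in> borel_measurable ?M"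
      by (subst measurable_cong[of _ _ "\<lambda>x. muD n (U x) (z x) (T x) (H x, E x)"])
        (simp_all only: muP[OF n(1) sp(2) T(2)[OF sp(1)]])
  qed auto
qed

end

theorem proposition9p5:
  fixes a b r :: real
    and Ds :: "nat \<Rightarrow> real list" and rs :: "nat \<Rightarrow> real"
    and muD :: "nat \<Rightarrow> (real \<Rightarrow> real) \<Rightarrow> real \<Rightarrow> real \<Rightarrow> ((real \<Rightarrow> real) \<times> real \<Rightarrow> real)"
    and muP :: "(real \<Rightarrow> real) \<Rightarrow> real \<Rightarrow> real \<Rightarrow> ((real \<Rightarrow> real) \<times> real \<Rightarrow> real)"
    and \<Omega> :: "'x measure"
    and u :: "'x \<Rightarrow> real \<Rightarrow> real" and z0 :: "'x \<Rightarrow> real"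
    and L :: "'x \<Rightarrow> (real \<Rightarrow> real) \<times> real \<Rightarrow> (real \<Rightarrow> real) set"
  assumes "a < b" and "r > 0"
    and "admissible_partitions a b Ds"
    and "admissible_radii r rs"
    and muD: "\<And>n. n \<ge> 1 \<Longrightarrow> muD n \<in> S_D a b r (Ds n)"
    and muP: "\<And>n v p t. n \<ge> 1 \<Longrightarrow> (v, p) \<in> Vbar a b Ds rs n - Vbar a b Ds rs (n - 1) \<Longrightarrow>
                t \<in> {a..b} \<Longrightarrow> muP v p t = muD n v p t"
    and u: "u \<in> measurable \<Omega> (borel_of (mtopology_of (CI {a..b})))"
    and z0: "z0 \<in> borel_measurable \<Omega>"
    and L: "\<And>x. x \<in> space \<Omega> \<Longrightarrow> L x = op_of a b (muP (u x) (z0 x))"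
  shows "(\<forall>x\<in>space \<Omega>. L x \<in> ops_CR_Linf a b \<and> L x \<in> G_P a b r Ds rs (u x) (z0 x)) \<and>
    (\<forall>h y. h \<in> measurable \<Omega> (borel_of (mtopology_of (CI {a..b}))) \<longrightarrow>
           y \<in> borel_measurable \<Omega> \<longrightarrow>
       (\<forall>x\<in>space \<Omega>. (\<lambda>t. muP (u x) (z0 x) t (h x, y x)) \<in> L x (h x, y x)) \<and>
       (\<lambda>(x, t). muP (u x) (z0 x) t (h x, y x)) \<in>
         borel_measurable (\<Omega> \<Otimes>\<^sub>M restrict_space borel {a..b}))"
proof (intro conjI ballI allI impI)
  note r = assms(2) and Ds = assms(3) and rs = assms(4)
  let ?X = "CIR {a..b}"
  have u_in: "u x \<in> mspace (CI {a..b})" if "x \<in> space \<Omega>" for x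
    by (rule measurable_CI_space[OF u that])
  \<comment> \<open>Here \<open>x\<close> is frozen and only the time varies. Without this
    measurability the class of the pointwise function would be empty and no element of
    \<open>Linf_space\<close>.\<close>
  have meas: "(\<lambda>t. muP (u x) (z0 x) t q) \<in> borel_measurable (leb_ab a b)"
    if x: "x \<in> space \<Omega>" and q: "q \<in> mspace ?X" for x q
  proof -
    have "(\<lambda>t. muP (u x) (z0 x) t (fst q, snd q)) \<in> borel_measurable (leb_ab a b)"
    proof (rule measurable_layers[OF r Ds rs muD muP, where U = "\<lambda>_. u x" and z = "\<lambda>_. z0 x" and T = "\<lambda>t. t"
          and H = "\<lambda>_. fst q" and E = "\<lambda>_. snd q"])
      show "(\<lambda>_. u x) \<in> measurable (leb_ab a b) (borel_of (mtopology_of (CI {a..b})))"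
        "(\<lambda>_. fst q) \<in> measurable (leb_ab a b) (borel_of (mtopology_of (CI {a..b})))"
        using u_in[OF x] q by (auto intro!: measurable_const)
      show "(\<lambda>t. t) \<in> borel_measurable (leb_ab a b)"
        by (intro measurable_restrict_space1 measurable_completion) simp
      show "t \<in> {a..b}" if "t \<in> space (leb_ab a b)" for t
        using that by (auto simp: space_restrict_space)
    qed simp_all
    then show ?thesis by simp
  qed
  {
    fix x assume x: "x \<in> space \<Omega>"
    obtain n where n: "1 \<le> n" "(u x, z0 x) \<in> Vbar a b Ds rs n - Vbar a b Ds rs (n - 1)"
      using layer_exists[OF r Ds rs u_in[OF x], of "z0 x"] by blast
    note part = admissible_is_partition[OF r Ds rs n(1)]
    have Z: "(u x, z0 x) \<in> Z_D a b r (Ds n)"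
      using Vbar_subset[OF r Ds rs n(1)] n(2) by blast
    \<comment> \<open>The layer depends on \<open>(u x, z0 x)\<close> and not on the time, so one
      \<open>n\<close> serves for the whole operator.\<close>
    note eq = muP[OF n]
    show ops: "L x \<in> ops_CR_Linf a b"
      unfolding L[OF x]
    proof (rule op_of_in_ops)
      show "muP (u x) (z0 x) t \<in> dual_CIR {a..b}" if "t \<in> {a..b}" for t
        unfolding eq[OF that] by (rule S_D_dual[OF part r muD[OF n(1)] Z that])
      show "\<bar>muP (u x) (z0 x) t (h, y)\<bar> \<le> B + \<bar>y\<bar>"
        if "t \<in> {a..b}" "h \<in> mspace (CI {a..b})" "\<And>s. s \<in> {a..b} \<Longrightarrow> \<bar>h s\<bar> \<le> B" for t h y B
        unfolding eq[OF that(1)] by (rule S_D_bound[OF part r muD[OF n(1)] Z that])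
    qed (rule meas[OF x])
    have "L x = op_of a b (muD n (u x) (z0 x))"
      unfolding L[OF x] by (rule op_of_cong[OF eq])
    with ops n muD[OF n(1)] show "L x \<in> G_P a b r Ds rs (u x) (z0 x)"
      unfolding G_P_def G_D_def by blast
  }
  fix h :: "'x \<Rightarrow> real \<Rightarrow> real" and y :: "'x \<Rightarrow> real"
  assume h: "h \<in> measurable \<Omega> (borel_of (mtopology_of (CI {a..b})))" and y: "y \<in> borel_measurable \<Omega>"
  show "(\<lambda>t. muP (u x) (z0 x) t (h x, y x)) \<in> L x (h x, y x)" if x: "x \<in> space \<Omega>" for x
  proof -
    have q: "(h x, y x) \<in> mspace ?X" using measurable_CI_space[OF h x] by simp
    show ?thesis
      unfolding L[OF x] op_of_def restrict_apply'[OF q] by (rule Linf_class_self[OF meas[OF x q]])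
  qed
  let ?M = "\<Omega> \<Otimes>\<^sub>M restrict_space borel {a..b}"
  have snd: "snd \<in> borel_measurable ?M"
    using measurable_snd[of \<Omega> "restrict_space borel {a..b}"]
    by (simp add: measurable_restrict_space2_iff)
  have snd_in: "snd p \<in> {a..b}" if "p \<in> space ?M" for p
    using that by (auto simp: space_pair_measure space_restrict_space)
  \<comment> \<open>The same lemma as for frozen \<open>x\<close>, now with both projections as
    varying arguments.\<close>
  have "(\<lambda>p. muP (u (fst p)) (z0 (fst p)) (snd p) (h (fst p), y (fst p))) \<in> borel_measurable ?M"
    by (rule measurable_layers[OF r Ds rs muD muP
          measurable_compose[OF measurable_fst u] measurable_compose[OF measurable_fst z0] snd snd_in
          measurable_compose[OF measurable_fst h] measurable_compose[OF measurable_fst y]])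
  then show "(\<lambda>(x, t). muP (u x) (z0 x) t (h x, y x)) \<in> borel_measurable ?M"
    by (simp add: case_prod_beta)
qed

end
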